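(* Let $C(\cdot)$ be an admissible cost function and consider the learnedLLA of capacity $n$ built from black-box list labeling arrays whose amortized insertion cost is bounded by $C(\cdot)$. There is a constant $K$ (independent of $n$ and of the input) such that for any sequence $\sigma$ of at most $n$ insertions with arbitrary (even adversarial) predicted ranks and maximum prediction error $\eta$, the learnedLLA incurs at most $K\, n\, C(\eta)$ total element movements, i.e. $O(nC(\eta))$.
   Context: Online list labeling: $n$ elements from a totally ordered universe $U$ arrive online and must be stored in sorted order in an array of $m$ slots; the slot of an element is its label, and if $x<y$ are stored then the label of $x$ is smaller than that of $y$. An element movement occurs each time an element is assigned a new label (including its first placement); the total cost is the number of element movements, and the amortized cost is total cost divided by the number of insertions. A list labeling array (LLA) is a (possibly randomized) data structure for this problem supporting Insert$(x)$ and Init$(S')$, where Init places a set $S'$ into an empty LLA using $O(|S'|)$ movements. $C(n')$ upper bounds the amortized cost of Insert into an LLA with capacity $n'$ and $2n'$ slots. A cost function $C$ is admissible if (1) for all $i,j$ with $i<2j$, $C(i)=O(C(j))$; (2) $C(n')=\Omega(\log n')$; (3) for all $j$, $\sum_{i=1}^\infty C(2^{j+i})/2^i=O(C(j))$. Predictions: each element $x$ has rank $r_x$, the number of elements smaller than it once all elements have arrived; on arrival $x$ comes with a predicted rank $\tilde r_x$. The prediction error is $\eta_x=|\tilde r_x-r_x|$ and the maximum error is $\eta=\max_x\eta_x$. The learnedLLA (capacity $n$, a power of 2) uses an array of $m=6n$ slots. Let $T$ be the complete binary tree over ranks $\{1,\dots,n\}$; the $i$th node at height $h$ has assigned ranks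 $\{2^h(i-1)+1,\dots,2^hi\}$ and assigned slots $\{6\cdot2^h(i-1)+1,\dots,6\cdot 2^hi\}$; for a node $P$, $|P|$ denotes its number of assigned ranks. At all times a set of nodes, the actual LLAs $P_1,\dots,P_\ell$ (ordered left to right), is maintained so that every root-to-leaf path of $T$ contains exactly one of them; each is a black-box LLA operating on its assigned slots (its labels offset by the first assigned slot minus 1), and all elements in $P_i$ are smaller than all elements in $P_j$ for $i<j$. Initially the actual LLAs are the $n$ leaves. To insert $x$: let $i_p$ and $i_s$ be the indices of the actual LLAs containing the predecessor and successor of $x$ (if there is no successor, $i_s=\ell$; if no predecessor, $i_p=1$), and let $i_x$ be the index of the actual LLA whose assigned ranks contain $\tilde r_x$. Insert $x$ into $P_i$ where $i=i_p$ if $i_p>i_x$, $i=i_s$ if $i_s<i_x$, and $i=i_x$ otherwise. If afterwards $P_i$ has density above $1/2$ (more than half its assigned slots occupied), merge: let $P_p$ be the parent of $P_i$ in $T$, let $S_p$ be the set of elements currently stored in the slots assigned to $P_p$, call Init$(S_p)$ on a new LLA for $P_p$; $P_p$ becomes an actual LLA and its descendants cease to be actual LLAs.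
   Formalization: Condition (3) of admissibility is read with O(C(2^j)), since with O(C(j)) no cost function is admissible; C is taken positive everywhere (also at 0), and black boxes are assumed to stay correct, with no cost bound, above capacity while slots are free. *)

theory Defs
  imports "HOL-Probability.Probability" "HOL-Library.Landau_Symbols"
begin

section \<open>Admissible cost functions\<close>

text \<open>
  Costs are positive, so that \<open>O\<close>-bounds are uniform over all arguments: the bound
  \<open>C i = O(C j)\<close> has one constant for all \<open>i < 2 * j\<close>. Positivity at \<open>0\<close>
  matters only for perfect predictions, whose bound is in terms of \<open>C 0\<close>.
\<close>

definition admissible :: "(nat \<Rightarrow> real) \<Rightarrow> bool" where
  "admissible C \<longleftrightarrow>
     (\<forall>k. C k > 0) \<and>
     (\<exists>c. \<forall>i j. i < 2 * j \<longrightarrow> C i \<le> c * C j) \<and>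
     C \<in> \<Omega>(\<lambda>k. ln (real k)) \<and>
     (\<forall>j. summable (\<lambda>i. C (2 ^ (j + Suc i)) / 2 ^ Suc i)) \<and>
     (\<lambda>j. \<Sum>i. C (2 ^ (j + Suc i)) / 2 ^ Suc i) \<in> O(\<lambda>j. C (2 ^ j))"

section \<open>List labeling arrays\<close>

text \<open>
  A labeling maps each stored element to its slot. An element is moved by an operation if it
  receives a new label; first placements count.
\<close>

type_synonym 'a labeling = "'a \<rightharpoonup> nat"

definition movements :: "'a labeling \<Rightarrow> 'a labeling \<Rightarrow> nat" where
  "movements old new = card {x \<in> dom new. old x \<noteq> new x}"

text \<open>
  A data structure with its random bits fixed is determined by its response to every history:
  \<open>A S xs\<close> is the labeling after \<open>Init S\<close> followed by the insertions of \<open>xs\<close> in order.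
\<close>

type_synonym 'a lla = "'a set \<Rightarrow> 'a list \<Rightarrow> 'a labeling"

definition histories :: "nat \<Rightarrow> ('a set \<times> 'a list) set" where
  "histories m = {(S, xs). finite S \<and> distinct xs \<and> S \<inter> set xs = {} \<and> card S + length xs \<le> m}"

definition is_lla :: "nat \<Rightarrow> 'a::linorder lla \<Rightarrow> bool" where
  "is_lla m A \<longleftrightarrow> (\<forall>(S, xs) \<in> histories m.
     dom (A S xs) = S \<union> set xs \<and>
     ran (A S xs) \<subseteq> {1..m} \<and>
     (\<forall>x \<in> S \<union> set xs. \<forall>y \<in> S \<union> set xs. x < y \<longrightarrow> the (A S xs x) < the (A S xs y)))"

definition init_cost :: "'a lla \<Rightarrow> 'a set \<Rightarrow> nat" where
  "init_cost A S = movements Map.empty (A S [])"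

definition insert_cost :: "'a lla \<Rightarrow> 'a set \<Rightarrow> 'a list \<Rightarrow> nat" where
  "insert_cost A S xs = (\<Sum>i < length xs. movements (A S (take i xs)) (A S (take (Suc i) xs)))"

text \<open>
  A randomized LLA with capacity \<open>k\<close> and \<open>2 * k\<close> slots; the operations do not depend on its
  random bits \<open>\<omega>\<close>. It works as long as there are free slots, but its cost guarantee covers
  only histories of at most \<open>k\<close> elements: amortized over any such history, \<open>Init S\<close> costs at
  most \<open>c0 * card S\<close> and each insertion at most \<open>C k\<close>. A deterministic LLA is a constant
  function of \<open>\<omega>\<close>.
\<close>

definition bounded_lla ::
    "'w measure \<Rightarrow> (nat \<Rightarrow> real) \<Rightarrow> real \<Rightarrow> nat \<Rightarrow> ('w \<Rightarrow> 'a::linorder lla) \<Rightarrow> bool" where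
  "bounded_lla M C c0 k B \<longleftrightarrow>
     (\<forall>\<omega> \<in> space M. is_lla (2 * k) (B \<omega>)) \<and>
     (\<forall>(S, xs) \<in> histories (2 * k). (\<lambda>\<omega>. B \<omega> S xs) \<in> measurable M (count_space UNIV)) \<and>
     (\<forall>(S, xs) \<in> histories k.
        (\<integral>\<omega>. real (init_cost (B \<omega>) S + insert_cost (B \<omega>) S xs) \<partial>M)
          \<le> c0 * real (card S) + C k * real (length xs))"

section \<open>The rank tree\<close>

text \<open>\<open>(h, i)\<close> is the \<open>i\<close>-th node at height \<open>h\<close>, counting from \<open>1\<close>.\<close>

type_synonym node = "nat \<times> nat"

definition tree :: "nat \<Rightarrow> node set" where
  "tree n = {(h, i). 1 \<le> i \<and> 2 ^ h * i \<le> n}"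

fun ranks :: "node \<Rightarrow> nat set" where
  "ranks (h, i) = {2 ^ h * (i - 1) + 1 .. 2 ^ h * i}"

fun slots :: "node \<Rightarrow> nat set" where
  "slots (h, i) = {6 * 2 ^ h * (i - 1) + 1 .. 6 * 2 ^ h * i}"

fun parent :: "node \<Rightarrow> node" where
  "parent (h, i) = (Suc h, (i + 1) div 2)"

section \<open>The learnedLLA\<close>

text \<open>
  An actual LLA is its node together with the history of its black box. A state is the list of
  actual LLAs from left to right. Random bits influence labels only, not the state.
\<close>

record 'a actual =
  node :: node
  base :: "'a set"
  inserted :: "'a list"

type_synonym 'a state = "'a actual list"

definition contents :: "'a actual \<Rightarrow> 'a set" where
  "contents P = base P \<union> set (inserted P)"

definition stored :: "'a state \<Rightarrow> 'a set" where
  "stored st = (\<Union>P \<in> set st. contents P)"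

definition initial_state :: "nat \<Rightarrow> 'a state" where
  "initial_state n = map (\<lambda>i. \<lparr>node = (0, i), base = {}, inserted = []\<rparr>) [1..<Suc n]"

definition index_of :: "('a actual \<Rightarrow> bool) \<Rightarrow> 'a state \<Rightarrow> nat" where
  "index_of Q st = (LEAST i. i < length st \<and> Q (st ! i))"

text \<open>Predictions outside \<open>{1..n}\<close>, the ranks assigned in the tree, are rounded to it.\<close>

definition clamp_rank :: "nat \<Rightarrow> nat \<Rightarrow> nat" where
  "clamp_rank n p = max 1 (min n p)"

definition target :: "nat \<Rightarrow> 'a::linorder \<Rightarrow> nat \<Rightarrow> 'a state \<Rightarrow> nat" where
  "target n x p st =
     (let smaller = {y \<in> stored st. y < x};
          larger = {y \<in> stored st. x < y};
          ip = (if smaller = {} then 0 else index_of (\<lambda>P. Max smaller \<in> contents P) st);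
          is = (if larger = {} then length st - 1 else index_of (\<lambda>P. Min larger \<in> contents P) st);
          ix = index_of (\<lambda>P. clamp_rank n p \<in> ranks (node P)) st
      in if ip > ix then ip else if is < ix then is else ix)"

definition insert_at :: "nat \<Rightarrow> 'a \<Rightarrow> 'a state \<Rightarrow> 'a state" where
  "insert_at i x st = st[i := (st ! i)\<lparr>inserted := inserted (st ! i) @ [x]\<rparr>]"

definition overfull :: "'a actual \<Rightarrow> bool" where
  "overfull P \<longleftrightarrow> 2 * card (contents P) > card (slots (node P))"

text \<open>The actual LLA for node \<open>Q\<close> after \<open>Init\<close> on the elements stored in the slots of \<open>Q\<close>.\<close>

definition merged :: "node \<Rightarrow> 'a state \<Rightarrow> 'a actual" where
  "merged Q st =
     \<lparr>node = Q, base = \<Union> {contents P | P. P \<in> set st \<and> slots (node P) \<subseteq> slots Q}, inserted = []\<rparr>"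

definition left_of :: "node \<Rightarrow> node \<Rightarrow> bool" where
  "left_of P Q \<longleftrightarrow> Max (ranks P) < Min (ranks Q)"

definition merge :: "node \<Rightarrow> 'a state \<Rightarrow> 'a state" where
  "merge Q st =
     filter (\<lambda>P. left_of (node P) Q) st @ [merged Q st] @ filter (\<lambda>P. left_of Q (node P)) st"

text \<open>
  An input is the sequence of arriving elements with their predicted ranks. No merge takes place
  at the root, as at most \<open>n\<close> of its \<open>6 * n\<close> slots are ever occupied.
\<close>

fun step :: "nat \<Rightarrow> 'a::linorder state \<Rightarrow> 'a \<times> nat \<Rightarrow> 'a state" where
  "step n st (x, p) =
     (let i = target n x p st;
          st' = insert_at i x st
      in if overfull (st' ! i) then merge (parent (node (st' ! i))) st' else st')"

definition run :: "nat \<Rightarrow> ('a::linorder \<times> nat) list \<Rightarrow> 'a state" where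
  "run n \<sigma> = foldl (step n) (initial_state n) \<sigma>"

text \<open>
  The black box at each node, and the labeling of the array of \<open>6 * n\<close> slots that results from
  the black boxes of the actual LLAs.
\<close>

type_synonym 'a boxes = "node \<Rightarrow> 'a lla"

definition actual_labels :: "'a boxes \<Rightarrow> 'a actual \<Rightarrow> 'a labeling" where
  "actual_labels B P =
     map_option (\<lambda>l. Min (slots (node P)) - 1 + l) \<circ> B (node P) (base P) (inserted P)"

definition array_labels :: "'a boxes \<Rightarrow> 'a state \<Rightarrow> 'a labeling" where
  "array_labels B st = foldr (\<lambda>P f. actual_labels B P ++ f) st Map.empty"

text \<open>
  \<open>Init\<close> in a merge starts from an empty LLA, so it pays for each element, even for those
  that happen to be put back into the same slot.
\<close>

fun step_cost :: "'a::linorder boxes \<Rightarrow> nat \<Rightarrow> 'a state \<Rightarrow> 'a \<times> nat \<Rightarrow> nat" where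
  "step_cost B n st (x, p) =
     (let i = target n x p st;
          st' = insert_at i x st
      in movements (array_labels B st) (array_labels B st') +
         (if overfull (st' ! i)
          then movements Map.empty (actual_labels B (merged (parent (node (st' ! i))) st'))
          else 0))"

definition total_cost :: "'a::linorder boxes \<Rightarrow> nat \<Rightarrow> ('a \<times> nat) list \<Rightarrow> nat" where
  "total_cost B n \<sigma> = (\<Sum>t < length \<sigma>. step_cost B n (run n (take t \<sigma>)) (\<sigma> ! t))"

section \<open>Prediction error\<close>

definition rank :: "('a::linorder \<times> nat) list \<Rightarrow> 'a \<Rightarrow> nat" where
  "rank \<sigma> x = card {y \<in> fst ` set \<sigma>. y < x}"

definition prediction_error :: "('a::linorder \<times> nat) list \<Rightarrow> 'a \<times> nat \<Rightarrow> nat" where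
  "prediction_error \<sigma> = (\<lambda>(x, p). nat \<bar>int p - int (rank \<sigma> x)\<bar>)"

definition max_error :: "('a::linorder \<times> nat) list \<Rightarrow> nat" where
  "max_error \<sigma> = Max (insert 0 (prediction_error \<sigma> ` set \<sigma>))"

end

(*
  An LLA at a node P is merged only when it holds more than 3 |P| elements. Its smallest element
  was predicted no further left than P and its largest no further right (otherwise they would have
  been placed next to a smaller, respectively larger, element of the same LLA), while their ranks
  differ by at least 3 |P|; hence the maximum error is at least |P|. So every actual LLA is a leaf
  or has |P| at most twice the maximum error, and an insertion costs O(C(eta)). All merges on one
  level of the tree cost O(n), and only O(log eta) = O(C(eta)) levels are ever used.
*)

theory Submission
  imports Defs
begin

section \<open>Admissible cost functions\<close>

text \<open>The guarantee of a black box bounds the expected cost of a whole history, not of a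
  single insertion, and it is silent once more than half of the slots are filled. So the cost of a
  live LLA cannot be charged insertion by insertion. Instead \<open>potential\<close> carries the
  exact expected movements made so far in each actual LLA, and the guarantee is invoked only when
  that LLA is merged away or the input ends.

  An LLA leaves the range of the guarantee by at most one insertion, the one that triggers its
  merge. This insertion gets the trivial bound of one movement per stored element. That is
  \<open>O(|P|)\<close> because density never exceeds 2/3: with \<open>6 * |P|\<close> slots, fewer
  than \<open>4 * |P|\<close> elements are present before any insertion. Disjoint nodes then pay
  \<open>O(n)\<close> per level for such insertions, as they do for \<open>Init\<close>.

  For a fixed input the states and merges are deterministic, so expectations are taken only of
  movements inside single boxes.\<close>

lemma admissible_quasi_mono:
  assumes "admissible C"
  obtains K where "\<And>i j. i \<le> 6 * j + 3 \<Longrightarrow> C i \<le> K * C j"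
proof -
  obtain c where c: "\<And>i j. i < 2 * j \<Longrightarrow> C i \<le> c * C j" and pos: "\<And>k. C k > 0"
    using assms unfolding admissible_def by blast
  have "c \<ge> 1"
    using c[of 1 1] pos[of 1] by (simp add: field_simps)
  \<comment> \<open>The range comes from the box capacity \<open>3 * |P|\<close> with
    \<open>|P| \<le> 2 * \<eta> + 1\<close>. For \<open>j \<ge> 2\<close> it lies strictly below
    \<open>8 * j\<close>. Admissibility needs \<open>i < 2 * j\<close> strictly, hence the chain
    through \<open>2 * j + 1\<close> and \<open>j + 1\<close> and a fourth factor
    \<open>c\<close>.\<close>
  have large: "C i \<le> c ^ 4 * C j" if "2 \<le> j" "i \<le> 6 * j + 3" for i j
  proof -
    have "C i \<le> c * C (4 * j)" using that by (intro c) auto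
    also have "\<dots> \<le> c * (c * C (2 * j + 1))" using \<open>c \<ge> 1\<close> by (intro mult_left_mono c) auto
    also have "\<dots> \<le> c * (c * (c * C (j + 1)))" using \<open>c \<ge> 1\<close> by (intro mult_left_mono c) auto
    also have "\<dots> \<le> c * (c * (c * (c * C j)))" using \<open>c \<ge> 1\<close> that by (intro mult_left_mono c) auto
    finally show ?thesis by (simp add: power4_eq_xxxx mult.assoc)
  qed
  \<comment> \<open>Admissibility relates nothing to \<open>C 0\<close>, so \<open>j < 2\<close> is
    settled by comparing the finitely many values up to \<open>6 * 1 + 3 = 9\<close>.\<close>
  define m where "m = min (C 0) (C 1)"
  define D where "D = Max (C ` {..9}) / m"
  have "m > 0" using pos by (simp add: m_def)
  have "Max (C ` {..9}) > 0" using pos by (subst Max_gr_iff) auto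
  then have "D \<ge> 0" using \<open>m > 0\<close> by (simp add: D_def)
  have small: "C i \<le> D * C j" if "j < 2" "i \<le> 6 * j + 3" for i j
  proof -
    have "C i \<le> Max (C ` {..9})" using that by (intro Max_ge) auto
    moreover have "C i \<le> D * m" if "C i \<le> Max (C ` {..9})" using that \<open>m > 0\<close> by (simp add: D_def)
    moreover have "m \<le> C j" using that by (auto simp: m_def less_2_cases_iff)
    then have "D * m \<le> D * C j" using \<open>D \<ge> 0\<close> by (rule mult_left_mono)
    ultimately show ?thesis by linarith
  qed
  have "C i \<le> max (c ^ 4) D * C j" if "i \<le> 6 * j + 3" for i j
  proof -
    have "c ^ 4 * C j \<le> max (c ^ 4) D * C j" "D * C j \<le> max (c ^ 4) D * C j"
      by (intro mult_right_mono less_imp_le[OF pos] max.cobounded1 max.cobounded2)+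
    then show ?thesis using large[of j i] small[of j i] that by fastforce
  qed
  then show ?thesis using that by blast
qed

text \<open>Nodes in use satisfy \<open>2 ^ h \<le> 2 * \<eta> + 1\<close>, so this bounds the
  number of levels in use by \<open>O(C \<eta>)\<close>. The lower bound on \<open>C\<close> is only
  asymptotic; below the threshold the minimum of finitely many positive values takes over.\<close>

lemma admissible_log_bound:
  assumes "admissible C"
  obtains K where "\<And>h j. 2 ^ h \<le> 2 * j + 1 \<Longrightarrow> real (h + 1) \<le> K * C j"
proof -
  have pos: "\<And>k. C k > 0" and "C \<in> \<Omega>(\<lambda>k. ln (real k))"
    using assms unfolding admissible_def by auto
  then obtain c N where "c > 0" and c: "\<And>k. k \<ge> N \<Longrightarrow> c * \<bar>ln (real k)\<bar> \<le> C k"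
    using pos by (elim landau_omega.bigE) (auto simp: eventually_sequentially abs_of_pos)
  \<comment> \<open>From 2 on, \<open>ln 2 \<le> ln j\<close>, which absorbs the additive
    constants.\<close>
  define N' where "N' = max N 2"
  have large: "real (h + 1) \<le> 4 / (c * ln 2) * C j" if "2 ^ h \<le> 2 * j + 1" "N' \<le> j" for h j
  proof -
    have j: "j \<ge> 2" "j \<ge> N" using that by (auto simp: N'_def)
    have "(2::real) ^ h \<le> real (2 * j + 1)"
      using that(1) by (metis of_nat_le_iff of_nat_numeral of_nat_power)
    also have "\<dots> \<le> 2 ^ 2 * real j" using j by simp
    finally have "ln ((2::real) ^ h) \<le> ln (2 ^ 2 * real j)"
      using j by (subst ln_le_cancel_iff) auto
    moreover have "ln (2 ^ 2 * real j) = 2 * ln 2 + ln (real j)"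
      using j ln_realpow[of 2 2] by (subst ln_mult) auto
    ultimately have "real h * ln 2 \<le> 2 * ln 2 + ln (real j)" by (simp add: ln_realpow)
    moreover have "ln 2 \<le> ln (real j)" using j by simp
    ultimately have "real (h + 1) * ln 2 \<le> 4 * ln (real j)" by (simp add: algebra_simps)
    also have "\<dots> \<le> 4 * (C j / c)"
      using c[OF j(2)] \<open>c > 0\<close> j by (simp add: field_simps)
    finally show ?thesis using \<open>c > 0\<close> by (simp add: field_simps)
  qed
  define m where "m = Min (C ` {..N'})"
  have "m > 0" using pos by (auto simp: m_def)
  define D where "D = (2 * real N' + 2) / m"
  have "D \<ge> 0" using \<open>m > 0\<close> by (simp add: D_def)
  have small: "real (h + 1) \<le> D * C j" if "2 ^ h \<le> 2 * j + 1" "j < N'" for h j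
  proof -
    have "h < 2 ^ h" by simp
    then have "h + 1 \<le> 2 * N' + 2" using that by linarith
    then have "real (h + 1) \<le> D * m" using \<open>m > 0\<close> by (simp add: D_def)
    also have "\<dots> \<le> D * C j"
      using that \<open>D \<ge> 0\<close> by (intro mult_left_mono) (auto simp: m_def)
    finally show ?thesis .
  qed
  have "real (h + 1) \<le> max (4 / (c * ln 2)) D * C j" if "2 ^ h \<le> 2 * j + 1" for h j
  proof -
    have "4 / (c * ln 2) * C j \<le> max (4 / (c * ln 2)) D * C j" "D * C j \<le> max (4 / (c * ln 2)) D * C j"
      by (intro mult_right_mono less_imp_le[OF pos] max.cobounded1 max.cobounded2)+
    then show ?thesis using large[of h j] small[of h j] that by fastforce
  qed
  then show ?thesis using that by blast
qed

section \<open>The rank tree\<close>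

lemma tree_snd_pos: "P \<in> tree n \<Longrightarrow> 1 \<le> snd P"
  by (auto simp: tree_def)

lemma card_ranks: "1 \<le> snd P \<Longrightarrow> card (ranks P) = 2 ^ fst P"
  by (cases P) (simp add: diff_mult_distrib2 Suc_diff_le)

lemma card_slots: "1 \<le> snd P \<Longrightarrow> card (slots P) = 6 * 2 ^ fst P"
  by (cases P) (simp add: diff_mult_distrib2 Suc_diff_le)

lemma card_slots_ranks: "1 \<le> snd P \<Longrightarrow> card (slots P) = 6 * card (ranks P)"
  by (simp add: card_ranks card_slots)

lemma finite_ranks [simp]: "finite (ranks P)"
  by (cases P) simp

text \<open>Writing the index as a successor removes the truncated subtraction in
  \<open>i - 1\<close>, so that linear arithmetic applies.\<close>

lemma ranks_Suc: "ranks (h, Suc j) = {2 ^ h * j + 1 .. 2 ^ h * j + 2 ^ h}"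
  by (simp add: algebra_simps)

lemma slots_Suc: "slots (h, Suc j) = {6 * (2 ^ h * j) + 1 .. 6 * (2 ^ h * j + 2 ^ h)}"
  by (simp add: algebra_simps)

lemma ranks_nonempty: "1 \<le> snd P \<Longrightarrow> ranks P \<noteq> {}"
  using card_ranks[of P] by force

text \<open>Slot intervals are rank intervals stretched by 6. A merge selects LLAs by their slots,
  whereas the invariants speak of ranks.\<close>

lemma slots_subset_iff:
  assumes "1 \<le> snd P" "1 \<le> snd Q"
  shows "slots P \<subseteq> slots Q \<longleftrightarrow> ranks P \<subseteq> ranks Q"
proof -
  obtain h i g j where "P = (h, Suc i)" "Q = (g, Suc j)"
    using assms by (metis One_nat_def Suc_le_D prod.collapse)
  moreover have "{6 * a + 1 .. 6 * (a + d)} \<subseteq> {6 * b + 1 .. 6 * (b + e)} \<longleftrightarrow> {a + 1 .. a + d} \<subseteq> {b + 1 .. b + e}"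
    if "0 < d" for a b d e :: nat
    using that by auto
  ultimately show ?thesis by (simp only: ranks_Suc slots_Suc zero_less_power pos2)
qed

lemma left_of_iff:
  assumes "1 \<le> snd P" "1 \<le> snd Q"
  shows "left_of P Q \<longleftrightarrow> (\<forall>r \<in> ranks P. \<forall>s \<in> ranks Q. r < s)"
  unfolding left_of_def using assms[THEN ranks_nonempty] by auto

text \<open>In units of \<open>2 ^ h\<close> the lower node is a unit cell and the higher one an
  interval with integer ends, so the cell cannot straddle an end.\<close>

lemma nested_or_separated_aux:
  assumes "h \<le> g"
  shows "left_of (h, Suc i) (g, Suc j) \<or> left_of (g, Suc j) (h, Suc i)
    \<or> ranks (h, Suc i) \<subseteq> ranks (g, Suc j)"
proof -
  define d where "d = g - h"
  have g: "2 ^ g * m = 2 ^ h * (2 ^ d * m)" for m :: nat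
    using assms by (simp add: d_def flip: power_add mult.assoc)
  have g1: "(2::nat) ^ g = 2 ^ h * 2 ^ d" using g[of 1] by simp
  consider "i + 1 \<le> 2 ^ d * j" | "2 ^ d * j + 2 ^ d \<le> i" | "2 ^ d * j \<le> i" "i + 1 \<le> 2 ^ d * j + 2 ^ d"
    by linarith
  then show ?thesis
  proof cases
    case 1
    then have "2 ^ h * (i + 1) \<le> 2 ^ h * (2 ^ d * j)" by (rule mult_le_mono2)
    then have "2 ^ h * i + 2 ^ h \<le> 2 ^ g * j" by (simp add: g)
    then show ?thesis by (auto simp: left_of_iff ranks_Suc simp del: ranks.simps)
  next
    case 2
    then have "2 ^ h * (2 ^ d * j + 2 ^ d) \<le> 2 ^ h * i" by (rule mult_le_mono2)
    then have "2 ^ g * j + 2 ^ g \<le> 2 ^ h * i" by (simp add: g g1 distrib_left)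
    then show ?thesis by (auto simp: left_of_iff ranks_Suc simp del: ranks.simps)
  next
    case 3
    then have "2 ^ h * (2 ^ d * j) \<le> 2 ^ h * i" "2 ^ h * (i + 1) \<le> 2 ^ h * (2 ^ d * j + 2 ^ d)"
      by (blast intro: mult_le_mono2)+
    then have "2 ^ g * j \<le> 2 ^ h * i" "2 ^ h * i + 2 ^ h \<le> 2 ^ g * j + 2 ^ g"
      by (simp_all add: g g1 distrib_left)
    then show ?thesis by (auto simp: ranks_Suc simp del: ranks.simps)
  qed
qed

lemma nested_or_separated:
  assumes "1 \<le> snd P" "1 \<le> snd Q"
  shows "left_of P Q \<or> left_of Q P \<or> ranks P \<subseteq> ranks Q \<or> ranks Q \<subseteq> ranks P"
proof -
  obtain h i g j where "P = (h, Suc i)" "Q = (g, Suc j)"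
    using assms by (metis One_nat_def Suc_le_D prod.collapse)
  then show ?thesis
    using nested_or_separated_aux[of h g i j] nested_or_separated_aux[of g h j i]
    by (metis linear)
qed

lemma ranks_subset_parent:
  assumes "1 \<le> snd P"
  shows "ranks P \<subseteq> ranks (parent P)"
proof -
  obtain h i where P: "P = (h, Suc i)"
    using assms by (metis One_nat_def Suc_le_D prod.collapse)
  have "2 * (i div 2) \<le> i" "i \<le> 2 * (i div 2) + 1" by linarith+
  then have "2 ^ h * (2 * (i div 2)) \<le> 2 ^ h * i" "2 ^ h * i \<le> 2 ^ h * (2 * (i div 2) + 1)"
    by (blast intro: mult_le_mono2)+
  moreover have "parent P = (Suc h, Suc (i div 2))" by (simp add: P)
  ultimately show ?thesis
    by (auto simp: P ranks_Suc algebra_simps simp del: ranks.simps parent.simps)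
qed

lemma fst_parent: "fst (parent P) = Suc (fst P)" and snd_parent: "1 \<le> snd P \<Longrightarrow> 1 \<le> snd (parent P)"
  by (cases P; simp)+

lemma parent_in_tree:
  assumes "P \<in> tree (2 ^ H)" "2 ^ fst P < (2::nat) ^ H"
  shows "parent P \<in> tree (2 ^ H)"
proof -
  obtain h i where P: "P = (h, i)" by fastforce
  from assms(2) obtain d where H: "H = h + Suc d"
    by (auto simp: P dest!: less_imp_Suc_add)
  have "i \<ge> 1" "2 ^ h * i \<le> 2 ^ h * 2 ^ Suc d"
    using assms(1) by (auto simp: P tree_def H power_add)
  then have "i \<le> 2 * 2 ^ d" by simp
  then have "(i + 1) div 2 \<le> 2 ^ d" by linarith
  then show ?thesis
    using \<open>i \<ge> 1\<close> by (auto simp: P tree_def H power_add)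
qed

lemma ranks_subset_of_tree: "P \<in> tree n \<Longrightarrow> ranks P \<subseteq> {1..n}"
  by (cases P) (auto simp: tree_def)

section \<open>Sums over lists\<close>

lemma sum_list_filter3:
  fixes f :: "'b \<Rightarrow> 'c::comm_monoid_add"
  assumes "\<And>x. x \<in> set xs \<Longrightarrow> (P x \<and> \<not> Q x \<and> \<not> R x) \<or> (\<not> P x \<and> Q x \<and> \<not> R x) \<or> (\<not> P x \<and> \<not> Q x \<and> R x)"
  shows "(\<Sum>x\<leftarrow>xs. f x)
    = (\<Sum>x\<leftarrow>filter P xs. f x) + (\<Sum>x\<leftarrow>filter Q xs. f x) + (\<Sum>x\<leftarrow>filter R xs. f x)"
  using assms
proof (induction xs)
  case (Cons x xs)
  from Cons.prems[of x] Cons.IH[OF Cons.prems] show ?case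
    by (auto simp: add_ac)
qed simp

lemma sum_list_linear:
  fixes a b :: real and f g :: "'b \<Rightarrow> nat"
  shows "(\<Sum>x\<leftarrow>xs. a * f x + b * g x) = a * (\<Sum>x\<leftarrow>xs. f x) + b * (\<Sum>x\<leftarrow>xs. g x)"
  by (induction xs) (simp_all add: algebra_simps)

section \<open>States of the learnedLLA\<close>

text \<open>Disjoint contents make cardinalities additive under merges and let each LLA's labels
  survive in the labeling of the whole array.\<close>

definition sep :: "'a actual \<Rightarrow> 'a actual \<Rightarrow> bool" where
  "sep P P' \<longleftrightarrow> left_of (node P) (node P') \<and> contents P \<inter> contents P' = {}"

definition push :: "'a \<Rightarrow> 'a actual \<Rightarrow> 'a actual" where
  "push x P = P\<lparr>inserted := inserted P @ [x]\<rparr>"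

lemma push_simps [simp]:
  "node (push x P) = node P" "base (push x P) = base P" "inserted (push x P) = inserted P @ [x]"
  "contents (push x P) = insert x (contents P)"
  by (auto simp: push_def contents_def)

lemma insert_at_append: "insert_at (length L) x (L @ P # R) = L @ push x P # R"
  by (simp add: insert_at_def push_def)

definition inner :: "node \<Rightarrow> 'a state \<Rightarrow> 'a state" where
  "inner Q st = filter (\<lambda>P. slots (node P) \<subseteq> slots Q) st"

lemma merged_simps [simp]:
  "node (merged Q st) = Q" "inserted (merged Q st) = []"
  "base (merged Q st) = (\<Union>P \<in> set (inner Q st). contents P)"
  "contents (merged Q st) = (\<Union>P \<in> set (inner Q st). contents P)"
  by (auto simp: merged_def contents_def inner_def)

lemma index_of_props:
  assumes "P \<in> set st" "Q P"
  shows "index_of Q st < length st" "Q (st ! index_of Q st)"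
proof -
  obtain i where "i < length st \<and> Q (st ! i)" using assms by (metis in_set_conv_nth)
  then have "index_of Q st < length st \<and> Q (st ! index_of Q st)"
    unfolding index_of_def by (rule LeastI)
  then show "index_of Q st < length st" "Q (st ! index_of Q st)" by auto
qed

locale predicted_input =
  fixes n H :: nat and \<sigma> :: "('a::linorder \<times> nat) list"
  assumes n_def: "n = 2 ^ H"
    and distinct_input: "distinct (map fst \<sigma>)"
    and length_input: "length \<sigma> \<le> n"
begin

abbreviation \<eta> :: nat where "\<eta> \<equiv> max_error \<sigma>"

text \<open>
  If \<open>x\<close> was placed right of its predicted leaf, this was because of a stored predecessor;
  dually for the successor. So in each actual LLA the maximum is predicted at most at the right
  end of its node and the minimum at least at the left end.
\<close>

definition guided :: "'a actual \<Rightarrow> bool" where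
  "guided P \<longleftrightarrow> (\<forall>x \<in> contents P. \<exists>p. (x, p) \<in> set \<sigma> \<and>
     (clamp_rank n p \<le> Max (ranks (node P)) \<or> (\<exists>z \<in> contents P. x < z)) \<and>
     (Min (ranks (node P)) \<le> clamp_rank n p \<or> (\<exists>z \<in> contents P. z < x)))"

text \<open>The bound \<open>2 * \<eta> + 1\<close> covers both origins of an LLA: a leaf has one
  rank, even if \<open>\<eta> = 0\<close>, and a merged node is twice as large as an overfull child,
  which \<open>overfull_error\<close> bounds by \<open>\<eta>\<close>.\<close>

definition sound :: "'a actual \<Rightarrow> bool" where
  "sound P \<longleftrightarrow> node P \<in> tree n \<and> finite (base P) \<and> distinct (inserted P) \<and>
     base P \<inter> set (inserted P) = {} \<and> guided P \<and> card (ranks (node P)) \<le> 2 * \<eta> + 1"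

text \<open>
  Two dense siblings may merge into an LLA that is already overfull, to which the cost guarantee
  of the black box does not apply. Still, its density stays below \<open>2/3\<close>, and it is merged by its
  very first insertion.
\<close>

definition settled :: "'a actual \<Rightarrow> bool" where
  "settled P \<longleftrightarrow> card (contents P) < 4 * card (ranks (node P)) \<and>
     (inserted P = [] \<or> card (contents P) \<le> 3 * card (ranks (node P)))"

text \<open>Separated tree nodes that cover all ranks are the same as one node on each root-to-leaf
  path: the path to a leaf consists of the nodes containing its rank.\<close>

definition valid :: "'a state \<Rightarrow> bool" where
  "valid st \<longleftrightarrow> (\<forall>P \<in> set st. sound P) \<and> sorted_wrt sep st \<and>
     {1..n} \<subseteq> (\<Union>P \<in> set st. ranks (node P))"

lemma sound_contents:
  assumes "sound P"
  shows "finite (contents P)" "card (contents P) = card (base P) + length (inserted P)"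
    "contents P \<subseteq> fst ` set \<sigma>" "1 \<le> snd (node P)"
proof -
  show "finite (contents P)" "card (contents P) = card (base P) + length (inserted P)"
    using assms by (auto simp: sound_def contents_def card_Un_disjoint distinct_card)
  show "contents P \<subseteq> fst ` set \<sigma>" using assms by (force simp: sound_def guided_def)
  show "1 \<le> snd (node P)" using assms tree_snd_pos unfolding sound_def by blast
qed

lemma validD:
  assumes "valid st" "P \<in> set st"
  shows "sound P" "1 \<le> snd (node P)"
  using assms sound_contents(4) unfolding valid_def by blast+

lemma overfull_iff: "sound P \<Longrightarrow> overfull P \<longleftrightarrow> card (contents P) > 3 * card (ranks (node P))"
  using card_slots_ranks[of "node P"] sound_contents(4)[of P] by (simp add: overfull_def)

section \<open>Overfull LLAs force a large prediction error\<close>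

lemma error_le:
  assumes "(x, p) \<in> set \<sigma>"
  shows "p \<le> rank \<sigma> x + \<eta>" "rank \<sigma> x \<le> p + \<eta>"
proof -
  have "prediction_error \<sigma> (x, p) \<le> \<eta>"
    unfolding max_error_def by (rule Max_ge) (use assms in auto)
  then show "p \<le> rank \<sigma> x + \<eta>" "rank \<sigma> x \<le> p + \<eta>" by (auto simp: prediction_error_def)
qed

lemma card_input: "card (fst ` set \<sigma>) = length \<sigma>"
  using distinct_card[OF distinct_input] by simp

lemma rank_le: "rank \<sigma> x \<le> n"
proof -
  have "rank \<sigma> x \<le> card (fst ` set \<sigma>)" unfolding rank_def by (rule card_mono) auto
  then show ?thesis using length_input card_input by simp
qed

lemma Max_Min_ranks: "1 \<le> snd Q \<Longrightarrow> Max (ranks Q) + 1 = Min (ranks Q) + card (ranks Q)"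
proof -
  assume "1 \<le> snd Q"
  then obtain h i where Q: "Q = (h, Suc i)" by (metis One_nat_def Suc_le_D prod.collapse)
  have "Max (ranks Q) = 2 ^ h * i + 2 ^ h" by (rule Max_eqI) (auto simp: Q ranks_Suc simp del: ranks.simps)
  moreover have "Min (ranks Q) = 2 ^ h * i + 1" by (rule Min_eqI) (auto simp: Q ranks_Suc simp del: ranks.simps)
  ultimately show ?thesis by (simp add: card_ranks Q del: ranks.simps)
qed

text \<open>The true ranks of the extreme elements differ by at least \<open>3 * |P|\<close>, their
  predictions by at most \<open>|P| - 1\<close> in that direction, and one more is lost to clamping.
  The two errors thus sum to at least \<open>2 * |P|\<close>, so one of them reaches
  \<open>|P|\<close>.\<close>

lemma overfull_error:
  assumes "sound P" "overfull P"
  shows "card (ranks (node P)) \<le> \<eta>"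
proof -
  let ?S = "contents P" and ?X = "fst ` set \<sigma>"
  define y where "y = Max ?S"
  define x where "x = Min ?S"
  have card: "card ?S > 3 * card (ranks (node P))" using assms by (simp add: overfull_iff)
  have fin: "finite ?S" "?S \<subseteq> ?X" using assms sound_contents by auto
  have ne: "?S \<noteq> {}" using card by force
  have y: "y \<in> ?S" "\<And>z. z \<in> ?S \<Longrightarrow> z \<le> y" and x: "x \<in> ?S" "\<And>z. z \<in> ?S \<Longrightarrow> x \<le> z"
    using fin ne by (auto simp: y_def x_def)
  have "x < y"
  proof (rule ccontr)
    assume "\<not> x < y"
    then have "?S \<subseteq> {x}" using x y by (metis insertI1 linorder_neqE order_antisym order_trans subsetI not_less)
    then have "card ?S \<le> 1" using card_mono[of "{x}" ?S] by simp
    moreover have "card (ranks (node P)) > 0" using card_ranks[OF sound_contents(4)[OF assms(1)]] by simp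
    ultimately show False using card by linarith
  qed
  have "rank \<sigma> x + (card ?S - 1) = card {z \<in> ?X. z < x} + card (?S - {y})"
    using y fin by (simp add: rank_def)
  also have "\<dots> = card ({z \<in> ?X. z < x} \<union> (?S - {y}))"
    using fin x by (intro card_Un_disjoint[symmetric]) (auto dest: leD)
  also have "\<dots> \<le> rank \<sigma> y"
    unfolding rank_def
  proof (intro card_mono subsetI)
    fix z assume "z \<in> {z \<in> ?X. z < x} \<union> (?S - {y})"
    then have "z \<in> ?X" "z < x \<or> z < y" using fin y by (auto simp: order.strict_iff_order)
    then show "z \<in> {z \<in> ?X. z < y}" using \<open>x < y\<close> less_trans by blast
  qed simp
  finally have gap: "rank \<sigma> x + card ?S \<le> rank \<sigma> y + 1" by linarith
  obtain p where p: "(y, p) \<in> set \<sigma>" "clamp_rank n p \<le> Max (ranks (node P))"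
    using assms(1) y unfolding sound_def guided_def by (meson not_less)
  obtain q where q: "(x, q) \<in> set \<sigma>" "Min (ranks (node P)) \<le> clamp_rank n q"
    using assms(1) x unfolding sound_def guided_def by (meson not_less)
  \<comment> \<open>True ranks start at 0 but tree ranks at 1, so clamping can raise a prediction by
    one; this is the \<open>+ 1\<close>. Clamping down to \<open>n\<close> is harmless because no
    rank exceeds \<open>n\<close>.\<close>
  have "rank \<sigma> y \<le> clamp_rank n p + \<eta>" "clamp_rank n q \<le> rank \<sigma> x + \<eta> + 1"
    using error_le[OF p(1)] error_le[OF q(1)] rank_le[of y] by (auto simp: clamp_rank_def)
  then show ?thesis
    using gap card p(2) q(2) Max_Min_ranks[OF sound_contents(4)[OF assms(1)]] by linarith
qed

section \<open>Disjointness and counting in valid states\<close>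

lemma valid_pairwise:
  assumes "valid st" "P \<in> set st" "P' \<in> set st" "P \<noteq> P'"
  shows "contents P \<inter> contents P' = {}" "ranks (node P) \<inter> ranks (node P') = {}"
proof -
  have "sep P P' \<or> sep P' P"
    using assms by (metis valid_def in_set_conv_nth linorder_neqE_nat sorted_wrt_nth_less)
  then show "contents P \<inter> contents P' = {}" "ranks (node P) \<inter> ranks (node P') = {}"
    using assms(1) assms(2,3)[THEN validD(2)[OF assms(1)]] by (auto simp: sep_def left_of_iff)
qed

lemma valid_distinct:
  assumes v: "valid st"
  shows "distinct st"
proof -
  have "st ! i \<noteq> st ! j" if "i < j" "j < length st" for i j
  proof
    assume eq: "st ! i = st ! j"
    have "sep (st ! i) (st ! j)"
      using that v by (simp add: valid_def sorted_wrt_nth_less)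
    moreover have "1 \<le> snd (node (st ! j))" using that validD(2)[OF v] by simp
    ultimately show False
      using ranks_nonempty[of "node (st ! j)"] by (auto simp: eq sep_def left_of_iff)
  qed
  then show "distinct st" by (metis distinct_conv_nth linorder_neqE_nat)
qed

lemma valid_sums:
  assumes v: "valid st" and "distinct xs" and sub: "set xs \<subseteq> set st"
  shows "(\<Sum>P\<leftarrow>xs. card (contents P)) = card (\<Union>P \<in> set xs. contents P)"
    "(\<Sum>P\<leftarrow>xs. card (ranks (node P))) = card (\<Union>P \<in> set xs. ranks (node P))"
proof -
  have fin: "\<forall>P \<in> set xs. finite (contents P)"
    using sub sound_contents(1) validD(1)[OF v] by auto
  have disj: "contents P \<inter> contents P' = {}" "ranks (node P) \<inter> ranks (node P') = {}"
    if "P \<in> set xs" "P' \<in> set xs" "P \<noteq> P'" for P P'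
    using valid_pairwise[OF v] that sub by (meson subsetD)+
  have "card (\<Union>P \<in> set xs. contents P) = (\<Sum>P \<in> set xs. card (contents P))"
    by (intro card_UN_disjoint fin) (simp_all add: disj)
  then show "(\<Sum>P\<leftarrow>xs. card (contents P)) = card (\<Union>P \<in> set xs. contents P)"
    using assms(2) by (simp add: sum_list_distinct_conv_sum_set)
  have "card (\<Union>P \<in> set xs. ranks (node P)) = (\<Sum>P \<in> set xs. card (ranks (node P)))"
    by (intro card_UN_disjoint) (simp_all add: disj)
  then show "(\<Sum>P\<leftarrow>xs. card (ranks (node P))) = card (\<Union>P \<in> set xs. ranks (node P))"
    using assms(2) by (simp add: sum_list_distinct_conv_sum_set)
qed

section \<open>The initial state and the place of an insertion\<close>

lemma valid_initial: "valid (initial_state n)" "P \<in> set (initial_state n) \<Longrightarrow> settled P"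
proof -
  have "sorted_wrt sep (initial_state n)"
    unfolding initial_state_def sorted_wrt_map
    by (rule sorted_wrt_mono_rel[OF _ sorted_wrt_upt]) (auto simp: sep_def left_of_def contents_def)
  moreover have "r \<in> ranks (0, r)" if "1 \<le> r" for r using that by simp
  ultimately show "valid (initial_state n)"
    by (auto simp: valid_def initial_state_def sound_def guided_def contents_def tree_def image_iff
      simp del: ranks.simps) (auto)
  show "P \<in> set (initial_state n) \<Longrightarrow> settled P"
    by (auto simp: initial_state_def settled_def contents_def)
qed

lemma stored_initial: "stored (initial_state n) = {}"
  by (auto simp: stored_def initial_state_def contents_def)

text \<open>This is what \<open>guided\<close> demands of a new element. If the predecessor forces
  \<open>x\<close> to the right of its predicted LLA, the upper condition holds by the order of the
  nodes and the predecessor is the witness for the lower one; the successor case is dual.\<close>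

lemma target_props:
  assumes v: "valid st"
  shows "target n x p st < length st"
    and "clamp_rank n p \<le> Max (ranks (node (st ! target n x p st))) \<or>
      (\<exists>z \<in> contents (st ! target n x p st). x < z)"
    and "Min (ranks (node (st ! target n x p st))) \<le> clamp_rank n p \<or>
      (\<exists>z \<in> contents (st ! target n x p st). z < x)"
proof -
  define smaller where "smaller = {y \<in> stored st. y < x}"
  define larger where "larger = {y \<in> stored st. x < y}"
  define pred where "pred = (if smaller = {} then 0 else index_of (\<lambda>P. Max smaller \<in> contents P) st)"
  define succ where "succ = (if larger = {} then length st - 1 else index_of (\<lambda>P. Min larger \<in> contents P) st)"
  define pos where "pos = index_of (\<lambda>P. clamp_rank n p \<in> ranks (node P)) st"
  have t: "target n x p st = (if pred > pos then pred else if succ < pos then succ else pos)"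
    unfolding target_def Let_def pred_def succ_def pos_def smaller_def larger_def by (rule refl)
  have fin: "finite (stored st)"
    using validD(1)[OF v] sound_contents(1) by (auto simp: stored_def)
  have "clamp_rank n p \<in> {1..n}" by (auto simp: clamp_rank_def n_def)
  then obtain P0 where "P0 \<in> set st" "clamp_rank n p \<in> ranks (node P0)"
    using v by (auto simp: valid_def)
  from index_of_props[of P0 st "\<lambda>P. clamp_rank n p \<in> ranks (node P)", OF this]
  have pos: "pos < length st" "clamp_rank n p \<in> ranks (node (st ! pos))" by (auto simp: pos_def)
  have sorted: "r < s"
    if "i < j" "j < length st" "r \<in> ranks (node (st ! i))" "s \<in> ranks (node (st ! j))" for i j r s
    using that v validD(2)[OF v] sorted_wrt_nth_less[of sep st i j]
    by (auto simp: valid_def sep_def left_of_iff)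
  have ends: "Min (ranks (node (st ! i))) \<in> ranks (node (st ! i))"
    "Max (ranks (node (st ! i))) \<in> ranks (node (st ! i))" if "i < length st" for i
    using that validD(2)[OF v] by (auto intro!: Min_in Max_in ranks_nonempty)
  have pred: "pred < length st" "\<exists>z \<in> contents (st ! pred). z < x" if "pred > pos"
  proof -
    \<comment> \<open>The default index 0 cannot exceed \<open>pos\<close>, so a predecessor
      exists.\<close>
    have ne: "smaller \<noteq> {}" using that by (auto simp: pred_def)
    then have M: "Max smaller \<in> smaller" using fin by (intro Max_in) (auto simp: smaller_def)
    then obtain P where "P \<in> set st" "Max smaller \<in> contents P"
      by (auto simp: smaller_def stored_def)
    from index_of_props[of P st "\<lambda>P. Max smaller \<in> contents P", OF this]
    show "pred < length st" "\<exists>z \<in> contents (st ! pred). z < x"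
      using ne M by (auto simp: pred_def smaller_def)
  qed
  have succ: "\<exists>z \<in> contents (st ! succ). x < z" if "succ < pos"
  proof -
    \<comment> \<open>The default is the last index, which cannot be below \<open>pos\<close>, so a
      successor exists.\<close>
    have ne: "larger \<noteq> {}" using that pos by (auto simp: succ_def)
    then have M: "Min larger \<in> larger" using fin by (intro Min_in) (auto simp: larger_def)
    then obtain P where "P \<in> set st" "Min larger \<in> contents P"
      by (auto simp: larger_def stored_def)
    from index_of_props[of P st "\<lambda>P. Min larger \<in> contents P", OF this]
    show "\<exists>z \<in> contents (st ! succ). x < z"
      using ne M by (auto simp: succ_def larger_def)
  qed
  show "target n x p st < length st" using t pred(1) pos(1) by auto
  consider "pred > pos" "target n x p st = pred" | "succ < pos" "target n x p st = succ"
    | "target n x p st = pos"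
    using t by metis
  then have "(clamp_rank n p \<le> Max (ranks (node (st ! target n x p st))) \<or>
      (\<exists>z \<in> contents (st ! target n x p st). x < z)) \<and>
    (Min (ranks (node (st ! target n x p st))) \<le> clamp_rank n p \<or>
      (\<exists>z \<in> contents (st ! target n x p st). z < x))"
  proof cases
    case 1
    then have "clamp_rank n p < Max (ranks (node (st ! pred)))"
      using pred pos sorted[of pos pred] ends by blast
    then show ?thesis using pred 1 by auto
  next
    case 2
    then have "Min (ranks (node (st ! succ))) < clamp_rank n p"
      using pos sorted[of succ pos] ends[of succ] by simp
    then show ?thesis using succ 2 by auto
  next
    case 3
    then show ?thesis using pos by auto
  qed
  then show "clamp_rank n p \<le> Max (ranks (node (st ! target n x p st))) \<or>
      (\<exists>z \<in> contents (st ! target n x p st). x < z)"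
    "Min (ranks (node (st ! target n x p st))) \<le> clamp_rank n p \<or>
      (\<exists>z \<in> contents (st ! target n x p st). z < x)" by blast+
qed

section \<open>Insertions and merges preserve validity\<close>

lemma valid_push:
  assumes "valid (L @ P # R)" "x \<notin> stored (L @ P # R)" "(x, p) \<in> set \<sigma>"
    "clamp_rank n p \<le> Max (ranks (node P)) \<or> (\<exists>z \<in> contents P. x < z)"
    "Min (ranks (node P)) \<le> clamp_rank n p \<or> (\<exists>z \<in> contents P. z < x)"
  shows "valid (L @ push x P # R)"
proof -
  have "sound P" using assms(1) by (simp add: valid_def)
  moreover have "guided (push x P)"
    using assms(3-) \<open>sound P\<close> unfolding guided_def sound_def by simp blast
  ultimately have "sound (push x P)"
    using assms(2) by (auto simp: sound_def stored_def contents_def)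
  then show ?thesis
    using assms(1,2) by (auto simp: valid_def sorted_wrt_append sep_def stored_def)
qed

text \<open>Tree nodes are nested or separated. The one bad case, an actual LLA whose node contains
  \<open>Q\<close>, is excluded because its ranks would overlap those of \<open>P\<close>, a child
  of \<open>Q\<close>.\<close>

lemma merge_cases:
  assumes "valid st" "P \<in> set st" "P' \<in> set st"
  defines "Q \<equiv> parent (node P)"
  shows "(left_of (node P') Q \<and> \<not> slots (node P') \<subseteq> slots Q \<and> \<not> left_of Q (node P')) \<or>
    (\<not> left_of (node P') Q \<and> slots (node P') \<subseteq> slots Q \<and> \<not> left_of Q (node P')) \<or>
    (\<not> left_of (node P') Q \<and> \<not> slots (node P') \<subseteq> slots Q \<and> left_of Q (node P'))"
proof -
  note pos = validD(2)[OF assms(1,2)] validD(2)[OF assms(1,3)]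
  have Q: "1 \<le> snd Q" unfolding Q_def by (rule snd_parent[OF pos(1)])
  have sub: "ranks (node P) \<subseteq> ranks Q" using pos by (simp add: Q_def ranks_subset_parent)
  have "ranks (node P') \<subseteq> ranks Q" if "ranks Q \<subseteq> ranks (node P')"
  proof (rule ccontr)
    assume "\<not> ?thesis"
    then have "P' \<noteq> P" using sub by auto
    then show False
      using valid_pairwise(2)[OF assms(1-3)] that sub ranks_nonempty[OF pos(1)] by auto
  qed
  then have "left_of (node P') Q \<or> left_of Q (node P') \<or> slots (node P') \<subseteq> slots Q"
    using nested_or_separated[OF pos(2) Q] slots_subset_iff[OF pos(2) Q] by blast
  then show ?thesis
    using ranks_nonempty[OF pos(2)] ranks_nonempty[OF Q]
    unfolding slots_subset_iff[OF pos(2) Q] left_of_iff[OF pos(2) Q] left_of_iff[OF Q pos(2)]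
    by (metis all_not_in_conv less_asym less_irrefl subsetD)
qed

lemma valid_merge:
  assumes v: "valid st" and P: "P \<in> set st" and over: "overfull P"
    and few: "card (contents P) \<le> 4 * card (ranks (node P))"
    and settled: "\<forall>P' \<in> set st. P' \<noteq> P \<longrightarrow> settled P'"
  defines "Q \<equiv> parent (node P)"
  shows "valid (merge Q st)" "\<And>P'. P' \<in> set (merge Q st) \<Longrightarrow> settled P'"
    "stored (merge Q st) = stored st" "Q \<in> tree n"
    "(\<Sum>P'\<leftarrow>inner Q st. card (ranks (node P'))) \<le> card (ranks Q)"
    "(\<Sum>P'\<leftarrow>inner Q st. card (contents P')) = card (base (merged Q st))"
    "card (base (merged Q st)) \<le> 4 * card (ranks Q)"
    "\<And>P'. P' \<in> set (inner Q st) \<Longrightarrow> card (ranks (node P')) \<le> card (ranks (node P))"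
proof -
  note sP = validD(1)[OF v P] and posP = validD(2)[OF v P]
  note cases = merge_cases[OF v P, folded Q_def]
  have Q: "1 \<le> snd Q" unfolding Q_def by (rule snd_parent[OF posP])
  have cardQ: "card (ranks Q) = 2 * card (ranks (node P))"
    using card_ranks[OF Q] card_ranks[OF posP] by (simp add: Q_def fst_parent)
  have inner: "P' \<in> set (inner Q st) \<longleftrightarrow> P' \<in> set st \<and> ranks (node P') \<subseteq> ranks Q" for P'
    using slots_subset_iff[OF validD(2)[OF v] Q, of P'] unfolding inner_def set_filter mem_Collect_eq
    by blast
  have Pin: "P \<in> set (inner Q st)" unfolding inner by (simp add: P Q_def ranks_subset_parent[OF posP])
  have dist: "distinct (inner Q st)" using valid_distinct[OF v] by (simp add: inner_def)
  have sub: "set (inner Q st) \<subseteq> set st" by (auto simp: inner_def)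
  \<comment> \<open>Any other absorbed node is disjoint from \<open>P\<close> inside
    \<open>Q\<close>, which is only twice as large as \<open>P\<close>. So no absorbed LLA is higher
    than \<open>P\<close>, and one level of allowance pays for the merge.\<close>
  show "card (ranks (node P')) \<le> card (ranks (node P))" if "P' \<in> set (inner Q st)" for P'
  proof (cases "P' = P")
    case False
    have "P' \<in> set st" "ranks (node P') \<subseteq> ranks Q" "ranks (node P) \<subseteq> ranks Q"
      using that Pin unfolding inner by blast+
    moreover from this have "ranks (node P') \<inter> ranks (node P) = {}"
      using valid_pairwise(2)[OF v _ P False] by blast
    ultimately have "card (ranks (node P')) + card (ranks (node P)) \<le> card (ranks Q)"
      by (subst card_Un_disjoint[symmetric]) (auto intro: card_mono)
    then show ?thesis using cardQ by simp
  qed simp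
  have fin: "finite (contents P')" if "P' \<in> set st" for P'
    using that validD(1)[OF v] sound_contents(1) by blast
  have "node P \<in> tree n" using sP by (simp add: sound_def)
  \<comment> \<open>An overfull node holds more than three times its size, but there are at most
    \<open>n\<close> elements, so it is not the root.\<close>
  have "2 ^ fst (node P) < (2::nat) ^ H"
  proof -
    have "3 * card (ranks (node P)) < card (contents P)" using over sP overfull_iff by simp
    also have "\<dots> \<le> card (fst ` set \<sigma>)" using sound_contents(3)[OF sP] by (intro card_mono) auto
    also have "\<dots> \<le> 2 ^ H" using card_input length_input n_def by simp
    finally show ?thesis using card_ranks[OF posP] by linarith
  qed
  then show tree: "Q \<in> tree n"
    using \<open>node P \<in> tree n\<close> unfolding Q_def n_def by (intro parent_in_tree)
  have cover: "\<exists>P' \<in> set (inner Q st). r \<in> ranks (node P')" if "r \<in> ranks Q" for r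
  proof -
    have "r \<in> {1..n}" using that tree ranks_subset_of_tree by blast
    then obtain P' where P': "P' \<in> set st" "r \<in> ranks (node P')" using v by (auto simp: valid_def)
    then have "slots (node P') \<subseteq> slots Q"
      using cases[OF P'(1)] that left_of_iff[OF Q validD(2)[OF v P'(1)]]
        left_of_iff[OF validD(2)[OF v P'(1)] Q] by blast
    then show ?thesis using P' by (auto simp: inner_def)
  qed
  have "(\<Sum>P'\<leftarrow>inner Q st. card (ranks (node P'))) = card (\<Union>P' \<in> set (inner Q st). ranks (node P'))"
    by (rule valid_sums(2)[OF v dist sub])
  also have "\<dots> \<le> card (ranks Q)" using inner by (intro card_mono) auto
  finally show sum_ranks: "(\<Sum>P'\<leftarrow>inner Q st. card (ranks (node P'))) \<le> card (ranks Q)" .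
  show sum_contents: "(\<Sum>P'\<leftarrow>inner Q st. card (contents P')) = card (base (merged Q st))"
    using valid_sums(1)[OF v dist sub] by simp
  \<comment> \<open>\<open>P\<close> itself may have reached \<open>4 * |P|\<close>. Another LLA
    must cover the rest of \<open>Q\<close>, and it is settled, hence strictly below that density;
    this keeps the merged LLA strictly below it as well.\<close>
  obtain P2 where P2: "P2 \<in> set (inner Q st)" "P2 \<noteq> P"
  proof -
    have "ranks Q \<noteq> ranks (node P)" using cardQ posP by (auto simp: card_ranks)
    then obtain r where "r \<in> ranks Q" "r \<notin> ranks (node P)"
      using Pin inner by blast
    then show ?thesis using that cover by blast
  qed
  have "(\<Sum>P' \<in> set (inner Q st). card (contents P')) < (\<Sum>P' \<in> set (inner Q st). 4 * card (ranks (node P')))"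
  proof (rule sum_strict_mono_ex1)
    show "\<forall>P' \<in> set (inner Q st). card (contents P') \<le> 4 * card (ranks (node P'))"
      using few settled sub by (metis less_imp_le settled_def subsetD)
    show "\<exists>P' \<in> set (inner Q st). card (contents P') < 4 * card (ranks (node P'))"
      using P2 settled sub by (metis settled_def subsetD)
  qed simp
  then have small: "card (base (merged Q st)) < 4 * card (ranks Q)"
    using sum_ranks sum_contents dist
    by (simp add: sum_list_distinct_conv_sum_set sum_distrib_left[symmetric])
  then show "card (base (merged Q st)) \<le> 4 * card (ranks Q)" by simp
  have set_merge: "set (merge Q st) =
      {P' \<in> set st. left_of (node P') Q} \<union> {merged Q st} \<union> {P' \<in> set st. left_of Q (node P')}"
    by (auto simp: merge_def)
  show "P' \<in> set (merge Q st) \<Longrightarrow> settled P'" for P'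
  proof -
    have "\<not> left_of (node P) Q" "\<not> left_of Q (node P)"
      using cases[OF P] Pin by (auto simp: inner_def)
    moreover have "settled (merged Q st)" using small by (simp add: settled_def)
    ultimately show "P' \<in> set (merge Q st) \<Longrightarrow> settled P'"
      using settled unfolding set_merge by auto
  qed
  show "stored (merge Q st) = stored st"
    using cases by (auto simp: stored_def set_merge) (fastforce simp: inner_def)+
  \<comment> \<open>Going from an absorbed LLA to \<open>Q\<close> only moves the ends of the node
    outwards and keeps all witnesses.\<close>
  have "guided (merged Q st)"
    unfolding guided_def
  proof
    fix x assume "x \<in> contents (merged Q st)"
    then obtain P' where P': "P' \<in> set (inner Q st)" "x \<in> contents P'" by auto
    have "ranks (node P') \<subseteq> ranks Q" "1 \<le> snd (node P')"
      using P' inner validD(2)[OF v] by auto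
    then have "Max (ranks (node P')) \<le> Max (ranks Q)" "Min (ranks Q) \<le> Min (ranks (node P'))"
      using ranks_nonempty by (auto intro: Max_mono Min_antimono)
    moreover have "guided P'" using P' inner validD(1)[OF v] by (auto simp: sound_def)
    moreover have "contents P' \<subseteq> contents (merged Q st)" using P' by auto
    ultimately show "\<exists>p. (x, p) \<in> set \<sigma> \<and>
        (clamp_rank n p \<le> Max (ranks (node (merged Q st))) \<or> (\<exists>z \<in> contents (merged Q st). x < z)) \<and>
        (Min (ranks (node (merged Q st))) \<le> clamp_rank n p \<or> (\<exists>z \<in> contents (merged Q st). z < x))"
      using P'(2) unfolding guided_def merged_simps(1) by (meson order_trans subsetD)
  qed
  then have "sound (merged Q st)"
    using tree sub fin overfull_error[OF sP over] cardQ by (auto simp: sound_def)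
  moreover have "sorted_wrt sep (merge Q st)"
  proof -
    have sorted: "sorted_wrt sep (filter X st)" for X
      using v by (auto simp: valid_def intro: sorted_wrt_filter)
    have "sep P' (merged Q st)" if "P' \<in> set st" "left_of (node P') Q" for P'
      using that cases[OF that(1)] valid_pairwise(1)[OF v that(1)]
      by (fastforce simp: sep_def inner_def)
    moreover have "sep (merged Q st) P'" if "P' \<in> set st" "left_of Q (node P')" for P'
      using that cases[OF that(1)] valid_pairwise(1)[OF v that(1)]
      by (fastforce simp: sep_def inner_def)
    moreover have "sep P1 P2"
      if "P1 \<in> set st" "left_of (node P1) Q" "P2 \<in> set st" "left_of Q (node P2)" for P1 P2
    proof -
      have "left_of (node P1) (node P2)"
        using that ranks_nonempty[OF Q] validD(2)[OF v] Q
        by (auto simp: left_of_iff) (metis less_trans)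
      moreover have "P1 \<noteq> P2" using that cases[OF that(1)] by blast
      ultimately show ?thesis using valid_pairwise(1)[OF v that(1,3)] by (simp add: sep_def)
    qed
    ultimately show ?thesis
      using sorted by (auto simp: merge_def sorted_wrt_append)
  qed
  moreover have "{1..n} \<subseteq> (\<Union>P' \<in> set (merge Q st). ranks (node P'))"
  proof
    fix r assume "r \<in> {1..n}"
    then obtain P' where P': "P' \<in> set st" "r \<in> ranks (node P')" using v by (auto simp: valid_def)
    show "r \<in> (\<Union>P' \<in> set (merge Q st). ranks (node P'))"
    proof (cases "P' \<in> set (inner Q st)")
      case True
      then show ?thesis using P' inner by (auto simp: set_merge)
    next
      case False
      then show ?thesis using P' cases[OF P'(1)] by (auto simp: set_merge inner_def)
    qed
  qed
  ultimately show "valid (merge Q st)"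
    using v by (auto simp: valid_def set_merge)
qed

end

section \<open>Costs\<close>

text \<open>\<open>array_labels\<close> combines maps by overriding; since contents are disjoint, no
  label is ever overridden.\<close>

lemma array_labels_at:
  assumes "sorted_wrt sep st" "\<And>P. P \<in> set st \<Longrightarrow> dom (actual_labels B P) = contents P"
  shows "dom (array_labels B st) = stored st"
    and "P \<in> set st \<Longrightarrow> y \<in> contents P \<Longrightarrow> array_labels B st y = actual_labels B P y"
proof -
  have "dom (array_labels B st) = stored st \<and>
    (\<forall>P \<in> set st. \<forall>y \<in> contents P. array_labels B st y = actual_labels B P y)"
    using assms
  proof (induction st)
    case (Cons P0 st)
    let ?f = "array_labels B st"
    have IH: "dom ?f = stored st" "\<And>P y. P \<in> set st \<Longrightarrow> y \<in> contents P \<Longrightarrow> ?f y = actual_labels B P y"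
      using Cons by auto
    have cons: "array_labels B (P0 # st) = actual_labels B P0 ++ ?f"
      by (simp add: array_labels_def)
    have "y \<notin> dom ?f" if "y \<in> contents P0" for y
      using Cons.prems(1) that unfolding IH(1) by (auto simp: stored_def sep_def)
    moreover have "y \<in> dom ?f" if "P \<in> set st" "y \<in> contents P" for P y
      using that unfolding IH(1) by (auto simp: stored_def)
    ultimately have "\<forall>P \<in> set (P0 # st). \<forall>y \<in> contents P. array_labels B (P0 # st) y = actual_labels B P y"
      unfolding cons using IH(2) by (auto simp: map_add_dom_app_simps)
    moreover have "dom (array_labels B (P0 # st)) = stored (P0 # st)"
      using IH(1) Cons.prems(2)[of P0] by (simp add: cons stored_def Un_commute)
    ultimately show ?case by blast
  qed (simp add: array_labels_def stored_def)
  then show "dom (array_labels B st) = stored st"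
    and "P \<in> set st \<Longrightarrow> y \<in> contents P \<Longrightarrow> array_labels B st y = actual_labels B P y" by auto
qed

lemma dom_actual_labels: "dom (actual_labels B P) = dom (B (node P) (base P) (inserted P))"
  by (auto simp: actual_labels_def dom_def)

text \<open>All other LLAs keep their history and hence their labels, and the slot offset of
  \<open>P\<close> is the same before and after, so the array moves exactly what the one box
  moves.\<close>

lemma movements_array_push:
  assumes st: "sorted_wrt sep (L @ P # R)" "sorted_wrt sep (L @ push x P # R)" "x \<notin> stored (L @ P # R)"
    and dom: "\<And>P'. P' \<in> {P, push x P} \<union> set L \<union> set R \<Longrightarrow> dom (actual_labels B P') = contents P'"
  shows "movements (array_labels B (L @ P # R)) (array_labels B (L @ push x P # R))
    = movements (B (node P) (base P) (inserted P)) (B (node P) (base P) (inserted P @ [x]))"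
proof -
  let ?st = "L @ P # R" and ?st' = "L @ push x P # R"
  let ?f = "B (node P) (base P) (inserted P)" and ?g = "B (node P) (base P) (inserted P @ [x])"
  have d: "\<And>P'. P' \<in> set ?st \<Longrightarrow> dom (actual_labels B P') = contents P'"
    "\<And>P'. P' \<in> set ?st' \<Longrightarrow> dom (actual_labels B P') = contents P'"
    using dom by auto
  note old = array_labels_at[OF st(1) d(1)] and new = array_labels_at[OF st(2) d(2)]
  have dfg: "dom ?f = contents P" "dom ?g = insert x (contents P)"
    using dom[of P] dom[of "push x P"] by (simp_all add: dom_actual_labels)
  have "y \<in> dom (array_labels B ?st') \<and> array_labels B ?st y \<noteq> array_labels B ?st' y
    \<longleftrightarrow> y \<in> dom ?g \<and> ?f y \<noteq> ?g y" for y
  proof (cases "y \<in> insert x (contents P)")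
    case True
    have g: "array_labels B ?st' y = actual_labels B (push x P) y"
      using True by (intro new(2)) auto
    have f: "array_labels B ?st y = actual_labels B P y"
    proof (cases "y \<in> contents P")
      case True
      then show ?thesis by (intro old(2)) auto
    next
      case False
      then have "y \<notin> stored ?st" using \<open>y \<in> insert x (contents P)\<close> st(3) by auto
      then show ?thesis using False old(1) d(1)[of P] by (metis domIff in_set_conv_decomp)
    qed
    have "actual_labels B P y = actual_labels B (push x P) y \<longleftrightarrow> ?f y = ?g y"
      by (cases "?f y"; cases "?g y") (simp_all add: actual_labels_def)
    then show ?thesis
      using True new(1) dfg(2) by (auto simp: f g stored_def)
  next
    case False
    have "array_labels B ?st y = array_labels B ?st' y" if y: "y \<in> stored ?st'"
    proof -
      obtain P' where "P' \<in> set L \<union> set R" "y \<in> contents P'"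
        using False y by (auto simp: stored_def)
      then show ?thesis using old(2)[of P' y] new(2)[of P' y] by auto
    qed
    then show ?thesis using False dfg(2) new(1) by auto
  qed
  then show ?thesis by (simp add: movements_def)
qed

section \<open>Movements and integrability for a single black box\<close>

lemma movements_empty: "movements Map.empty f = card (dom f)"
  unfolding movements_def by (rule arg_cong[of _ _ card]) (auto simp: dom_def)

lemma movements_le: "finite (dom g) \<Longrightarrow> movements f g \<le> card (dom g)"
  unfolding movements_def by (intro card_mono) auto

lemma insert_cost_snoc:
  "insert_cost A S (xs @ [x]) = insert_cost A S xs + movements (A S xs) (A S (xs @ [x]))"
  by (simp add: insert_cost_def)

lemma histories_take: "(S, xs) \<in> histories m \<Longrightarrow> (S, take i xs) \<in> histories m"
  by (auto simp: histories_def dest: in_set_takeD)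

lemma bounded_lla_box:
  assumes "bounded_lla M C c0 k B" "(S, xs) \<in> histories (2 * k)" "\<omega> \<in> space M"
  shows "dom (B \<omega> S xs) = S \<union> set xs" "ran (B \<omega> S xs) \<subseteq> {1..2 * k}"
proof -
  have "is_lla (2 * k) (B \<omega>)" using assms by (simp add: bounded_lla_def)
  then show "dom (B \<omega> S xs) = S \<union> set xs" "ran (B \<omega> S xs) \<subseteq> {1..2 * k}"
    using assms(2) unfolding is_lla_def by (auto dest!: bspec[where x = "(S, xs)"])
qed

text \<open>A fixed history allows only finitely many labelings, so every quantity computed from
  them is a simple function of the random bits. This holds up to the number of slots, beyond the
  range of the cost guarantee.\<close>

lemma simple_function_box:
  assumes "bounded_lla M C c0 k B" "(S, xs) \<in> histories (2 * k)"
  shows "simple_function M (\<lambda>\<omega>. B \<omega> S xs)"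
proof -
  have meas: "(\<lambda>\<omega>. B \<omega> S xs) \<in> measurable M (count_space UNIV)"
    using assms by (auto simp: bounded_lla_def dest: bspec[where x = "(S, xs)"])
  have "(\<lambda>\<omega>. B \<omega> S xs) ` space M \<subseteq> {f. dom f = S \<union> set xs \<and> ran f \<subseteq> {1..2 * k}}"
    using bounded_lla_box[OF assms] by blast
  moreover have "finite {f :: 'b \<rightharpoonup> nat. dom f = S \<union> set xs \<and> ran f \<subseteq> {1..2 * k}}"
    using assms(2) by (intro finite_set_of_finite_maps) (auto simp: histories_def)
  ultimately have "finite ((\<lambda>\<omega>. B \<omega> S xs) ` space M)" by (rule finite_subset)
  then show ?thesis
    using meas by (auto simp: simple_function_def intro: measurable_sets)
qed

context prob_space
begin

lemma integrable_movements:
  assumes "bounded_lla M C c0 k B" "(S, xs) \<in> histories (2 * k)" "(S, ys) \<in> histories (2 * k)"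
  shows "integrable M (\<lambda>\<omega>. real (movements (B \<omega> S xs) (B \<omega> S ys)))"
    "expectation (\<lambda>\<omega>. real (movements (B \<omega> S xs) (B \<omega> S ys))) \<le> real (card (S \<union> set ys))"
    "expectation (\<lambda>\<omega>. real (movements (B \<omega> S xs) (B \<omega> S ys))) \<ge> 0"
proof -
  have le: "movements (B \<omega> S xs) (B \<omega> S ys) \<le> card (S \<union> set ys)" if "\<omega> \<in> space M" for \<omega>
    using movements_le[of "B \<omega> S ys" "B \<omega> S xs"] bounded_lla_box(1)[OF assms(1,3) that] assms(3)
    by (auto simp: histories_def)
  have "(\<lambda>\<omega>. real (movements (B \<omega> S xs) (B \<omega> S ys))) \<in> borel_measurable M"
    using simple_function_compose2[OF simple_function_box[OF assms(1,2)] simple_function_box[OF assms(1,3)],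
      of "\<lambda>f g. real (movements f g)"]
    by (rule borel_measurable_simple_function)
  then show int: "integrable M (\<lambda>\<omega>. real (movements (B \<omega> S xs) (B \<omega> S ys)))"
    using le by (intro integrable_const_bound[where B = "real (card (S \<union> set ys))"]) auto
  show "expectation (\<lambda>\<omega>. real (movements (B \<omega> S xs) (B \<omega> S ys))) \<le> real (card (S \<union> set ys))"
    using integral_mono[OF int integrable_const[of "real (card (S \<union> set ys))"]] le
    by (simp add: prob_space)
qed simp

lemma integrable_insert_cost:
  assumes "bounded_lla M C c0 k B" "(S, xs) \<in> histories (2 * k)"
  shows "integrable M (\<lambda>\<omega>. real (insert_cost (B \<omega>) S xs))"
  unfolding insert_cost_def of_nat_sum using assms
  by (intro Bochner_Integration.integrable_sum integrable_movements histories_take)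

end

text \<open>\<open>D\<close> is one insertion price for all nodes that can occur: by
  \<open>sound\<close> their size \<open>2 ^ h\<close> is at most \<open>2 * \<eta> + 1\<close>, and
  their capacity is half of their \<open>6 * 2 ^ h\<close> slots.\<close>

locale random_boxes = predicted_input n H \<sigma> + prob_space M
  for n H and \<sigma> :: "('a::linorder \<times> nat) list" and M :: "'w measure" +
  fixes B :: "node \<Rightarrow> 'w \<Rightarrow> 'a lla" and C :: "nat \<Rightarrow> real" and c0 D :: real
  assumes boxes: "\<And>P. P \<in> tree n \<Longrightarrow> bounded_lla M C c0 (3 * card (ranks P)) (B P)"
    and C_pos: "\<And>k. 0 < C k"
    and C_le: "\<And>h. 2 ^ h \<le> 2 * \<eta> + 1 \<Longrightarrow> C (3 * 2 ^ h) \<le> D"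
begin

section \<open>Expected insertion cost of an actual LLA\<close>

definition box_cost :: "'a actual \<Rightarrow> real" where
  "box_cost P = expectation (\<lambda>\<omega>. real (insert_cost (B (node P) \<omega>) (base P) (inserted P)))"

lemma D_pos: "0 < D"
  using C_pos[of 3] C_le[of 0] by simp

lemma bounded_box: "sound P \<Longrightarrow> bounded_lla M C c0 (3 * card (ranks (node P))) (B (node P))"
  by (rule boxes) (simp add: sound_def)

lemma history:
  assumes "sound P" "card (contents P) \<le> m"
  shows "(base P, inserted P) \<in> histories m"
  using assms sound_contents(2)[OF assms(1)] by (simp add: histories_def sound_def)

text \<open>Correctness of a box extends to all \<open>6 * |P|\<close> slots, which leaves room for
  overfull LLAs.\<close>

lemma dom_box:
  assumes "sound P" "card (contents P) \<le> 4 * card (ranks (node P))" "\<omega> \<in> space M"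
  shows "dom (actual_labels (\<lambda>P. B P \<omega>) P) = contents P"
  using bounded_lla_box(1)[OF bounded_box[OF assms(1)] history[OF assms(1)] assms(3)] assms(2)
  by (simp add: dom_actual_labels contents_def)

text \<open>The guarantee covers \<open>Init\<close> and insertions together. The constant,
  nonnegative cost of \<open>Init\<close> is dropped here, as it is accounted for at the merge that
  calls it. A settled LLA beyond capacity has seen no insertion and costs nothing.\<close>

lemma box_cost_le:
  assumes "sound P" "settled P"
  shows "box_cost P \<le> \<bar>c0\<bar> * card (base P) + D * length (inserted P)"
proof (cases "inserted P = []")
  case True
  then show ?thesis by (simp add: box_cost_def insert_cost_def)
next
  case False
  let ?k = "3 * card (ranks (node P))"
  let ?B = "B (node P)" and ?S = "base P" and ?xs = "inserted P"
  note pos = sound_contents(4)[OF assms(1)]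
  have hist: "(?S, ?xs) \<in> histories ?k" "(?S, ?xs) \<in> histories (2 * ?k)" "(?S, []) \<in> histories (2 * ?k)"
    using history[OF assms(1), of ?k] False assms(2) by (auto simp: settled_def histories_def)
  note B = bounded_box[OF assms(1)]
  have init: "init_cost (?B \<omega>) ?S = card ?S" if "\<omega> \<in> space M" for \<omega>
    using bounded_lla_box(1)[OF B hist(3) that] by (simp add: init_cost_def movements_empty)
  have "box_cost P \<le> real (card ?S) + box_cost P" by simp
  also have "\<dots> = expectation (\<lambda>\<omega>. real (card ?S) + real (insert_cost (?B \<omega>) ?S ?xs))"
    using integrable_insert_cost[OF B hist(2)] by (simp add: box_cost_def prob_space)
  also have "\<dots> = expectation (\<lambda>\<omega>. real (init_cost (?B \<omega>) ?S + insert_cost (?B \<omega>) ?S ?xs))"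
    by (intro Bochner_Integration.integral_cong) (simp_all add: init)
  also have "\<dots> \<le> c0 * real (card ?S) + C ?k * real (length ?xs)"
    using B hist(1) by (auto simp: bounded_lla_def dest: bspec[where x = "(?S, ?xs)"])
  also have "\<dots> \<le> \<bar>c0\<bar> * real (card ?S) + D * real (length ?xs)"
  proof (intro add_mono mult_right_mono)
    have "2 ^ fst (node P) \<le> 2 * \<eta> + 1" using assms(1) card_ranks[OF pos] by (simp add: sound_def)
    from C_le[OF this] show "C ?k \<le> D" using card_ranks[OF pos] by simp
  qed auto
  finally show ?thesis .
qed

text \<open>The last bound is the trivial one, at most one movement per stored element; it remains
  available for the insertion that exceeds the capacity.\<close>

lemma box_cost_push:
  assumes "sound P" "sound (push x P)" "card (contents P) < 4 * card (ranks (node P))" "x \<notin> contents P"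
  defines "f \<equiv> \<lambda>\<omega>. real (movements (B (node P) \<omega> (base P) (inserted P)) (B (node P) \<omega> (base P) (inserted P @ [x])))"
  shows "integrable M f" "box_cost (push x P) = box_cost P + expectation f"
    "0 \<le> expectation f" "expectation f \<le> 4 * card (ranks (node P))"
proof -
  let ?k = "2 * (3 * card (ranks (node P)))"
  have card: "card (contents (push x P)) = card (contents P) + 1"
    using assms(4) sound_contents(1)[OF assms(1)] by simp
  have hist: "(base P, inserted P) \<in> histories ?k" "(base P, inserted P @ [x]) \<in> histories ?k"
    using history[OF assms(1), of ?k] history[OF assms(2), of ?k] assms(3) card by simp_all
  note mov = integrable_movements[OF bounded_box[OF assms(1)] hist]
  show "integrable M f" "0 \<le> expectation f" using mov unfolding f_def by blast+
  show "box_cost (push x P) = box_cost P + expectation f"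
    using mov integrable_insert_cost[OF bounded_box[OF assms(1)] hist(1)]
    by (simp add: box_cost_def f_def insert_cost_snoc)
  have "base P \<union> set (inserted P @ [x]) = contents (push x P)" by (simp add: contents_def)
  then have "expectation f \<le> card (contents (push x P))" using mov(2) unfolding f_def by simp
  then show "expectation f \<le> 4 * card (ranks (node P))" using card assms(3) by linarith
qed

text \<open>Per rank and level, \<open>4 * \<bar>c0\<bar>\<close> pays the share of the guarantee
  due to the bases of absorbed LLAs, 4 pays the insertion beyond capacity, and another 4 pays
  \<open>Init\<close> of the merged LLA.\<close>

definition A :: real where
  "A = 4 * \<bar>c0\<bar> + 8"

text \<open>
  The cost of all insertions into LLAs that have been merged away is charged to the elements of
  \<open>base P\<close>; the cost of the merges themselves is \<open>O(card (ranks (node P)))\<close> on each level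
  below \<open>P\<close>.
\<close>

definition weight :: "'a actual \<Rightarrow> real" where
  "weight P = box_cost P + D * card (base P) + A * fst (node P) * card (ranks (node P))"

definition potential :: "'a state \<Rightarrow> real" where
  "potential st = (\<Sum>P\<leftarrow>st. weight P)"

lemma weight_le:
  assumes "sound P" "card (contents P) \<le> 4 * card (ranks (node P))"
    "box_cost P \<le> \<bar>c0\<bar> * card (base P) + D * length (inserted P) + 4 * card (ranks (node P))"
    "fst (node P) \<le> h"
  shows "weight P \<le> D * card (contents P) + (A * h + 4 * \<bar>c0\<bar> + 4) * card (ranks (node P))"
proof -
  have card: "card (contents P) = card (base P) + length (inserted P)"
    by (rule sound_contents(2)[OF assms(1)])
  have "\<bar>c0\<bar> * card (base P) \<le> \<bar>c0\<bar> * (4 * card (ranks (node P)))"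
    using assms(2) card by (intro mult_left_mono) auto
  moreover have "A * fst (node P) * card (ranks (node P)) \<le> A * h * card (ranks (node P))"
    using assms(4) by (intro mult_right_mono mult_left_mono) (auto simp: A_def)
  ultimately show ?thesis
    using assms(3) by (simp add: weight_def card algebra_simps)
qed

text \<open>The price \<open>D\<close> of an insertion passes with its element into the base of the
  merged LLA, so it is never paid twice. All other costs are proportional to ranks and fit into the
  allowance gained by rising one level.\<close>

lemma potential_merge:
  assumes v: "valid st" and P: "P \<in> set st" and over: "overfull P"
    and few: "card (contents P) \<le> 4 * card (ranks (node P))"
    and cost: "box_cost P \<le> \<bar>c0\<bar> * card (base P) + D * length (inserted P) + 4 * card (ranks (node P))"
    and settled: "\<forall>P' \<in> set st. P' \<noteq> P \<longrightarrow> settled P'"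
  defines "Q \<equiv> parent (node P)"
  shows "potential st + card (base (merged Q st)) \<le> potential (merge Q st)"
proof -
  define h where "h = fst (node P)"
  define c where "c = A * h + 4 * \<bar>c0\<bar> + 4"
  have "c \<ge> 0" by (simp add: c_def A_def)
  note merge = valid_merge[OF v P over few settled, folded Q_def]
  have inner: "P' \<in> set st" if "P' \<in> set (inner Q st)" for P'
    using that by (simp add: inner_def)
  have "weight P' \<le> D * card (contents P') + c * card (ranks (node P'))"
    if P': "P' \<in> set (inner Q st)" for P'
  proof -
    have s: "sound P'" using validD(1)[OF v inner[OF P']] .
    have "(2::nat) ^ fst (node P') \<le> 2 ^ h"
      using merge(8)[OF P'] card_ranks[OF sound_contents(4)[OF s]] card_ranks[OF validD(2)[OF v P]]
      by (simp add: h_def)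
    then have "fst (node P') \<le> h" by simp
    moreover have "card (contents P') \<le> 4 * card (ranks (node P')) \<and>
        box_cost P' \<le> \<bar>c0\<bar> * card (base P') + D * length (inserted P') + 4 * card (ranks (node P'))"
    proof (cases "P' = P")
      case False
      then have "settled P'" using settled inner[OF P'] by blast
      then show ?thesis using box_cost_le[OF s] by (fastforce simp: settled_def)
    qed (use few cost in auto)
    ultimately show ?thesis unfolding c_def using weight_le[OF s] by blast
  qed
  then have "(\<Sum>P'\<leftarrow>inner Q st. weight P')
      \<le> (\<Sum>P'\<leftarrow>inner Q st. D * card (contents P') + c * card (ranks (node P')))"
    by (intro sum_list_mono)
  also have "\<dots> = D * (\<Sum>P'\<leftarrow>inner Q st. card (contents P')) + c * (\<Sum>P'\<leftarrow>inner Q st. card (ranks (node P')))"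
    by (rule sum_list_linear)
  also have "\<dots> \<le> D * card (base (merged Q st)) + c * card (ranks Q)"
    unfolding merge(6) using merge(5) \<open>c \<ge> 0\<close> by (intro add_left_mono mult_left_mono) linarith
  finally have "(\<Sum>P'\<leftarrow>inner Q st. weight P') + card (base (merged Q st))
      \<le> D * card (base (merged Q st)) + (c + 4) * card (ranks Q)"
    using merge(7) by (simp add: algebra_simps)
  \<comment> \<open>The merged LLA has no insertions yet, so its box cost is 0, and
    \<open>c + 4 = A * (h + 1)\<close> by the choice of \<open>A\<close>.\<close>
  also have "\<dots> = weight (merged Q st)"
    by (simp add: weight_def box_cost_def insert_cost_def c_def h_def Q_def fst_parent A_def algebra_simps)
  finally have "(\<Sum>P'\<leftarrow>inner Q st. weight P') + card (base (merged Q st)) \<le> weight (merged Q st)" .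
  moreover have "potential st = (\<Sum>P'\<leftarrow>filter (\<lambda>P'. left_of (node P') Q) st. weight P')
      + (\<Sum>P'\<leftarrow>inner Q st. weight P') + (\<Sum>P'\<leftarrow>filter (\<lambda>P'. left_of Q (node P')) st. weight P')"
    unfolding potential_def inner_def
    by (rule sum_list_filter3) (rule merge_cases[OF v P, folded Q_def])
  ultimately show ?thesis by (simp add: potential_def merge_def)
qed

text \<open>The insertion raises \<open>box_cost\<close> by exactly its expected movements, so the
  potential grows with equality; only a merge uses an inequality.\<close>

lemma step_bound:
  assumes v: "valid st" and settled: "\<And>P. P \<in> set st \<Longrightarrow> settled P"
    and x: "x \<notin> stored st" "(x, p) \<in> set \<sigma>"
  defines "cost \<equiv> \<lambda>\<omega>. real (step_cost (\<lambda>P. B P \<omega>) n st (x, p))"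
  shows "valid (step n st (x, p))" "\<And>P. P \<in> set (step n st (x, p)) \<Longrightarrow> settled P"
    "stored (step n st (x, p)) = insert x (stored st)"
    "integrable M cost" "potential st + expectation cost \<le> potential (step n st (x, p))"
proof -
  define i where "i = target n x p st"
  define P where "P = st ! i"
  define L where "L = take i st"
  define R where "R = drop (Suc i) st"
  have i: "i < length st" using target_props(1)[OF v] by (simp add: i_def)
  have st: "st = L @ P # R" using id_take_nth_drop[OF i] by (simp add: L_def P_def R_def)
  have len: "length L = i" using i by (simp add: L_def)
  define st' where "st' = L @ push x P # R"
  have ins: "insert_at i x st = st'" unfolding st'_def by (subst st) (simp add: insert_at_append flip: len)
  have st'_i: "st' ! i = push x P" by (simp add: st'_def flip: len)
  define Q where "Q = parent (node P)"
  have step: "step n st (x, p) = (if overfull (push x P) then merge Q st' else st')"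
    using ins st'_i by (simp add: Let_def i_def Q_def)
  have v': "valid st'"
    unfolding st'_def
  proof (rule valid_push)
    show "valid (L @ P # R)" "x \<notin> stored (L @ P # R)" using v x(1) unfolding st by blast+
    show "clamp_rank n p \<le> Max (ranks (node P)) \<or> (\<exists>z \<in> contents P. x < z)"
      "Min (ranks (node P)) \<le> clamp_rank n p \<or> (\<exists>z \<in> contents P. z < x)"
      unfolding P_def i_def by (rule target_props[OF v])+
  qed (rule x(2))
  have sP: "sound P" using validD(1)[OF v] st by auto
  have sP': "sound (push x P)" using validD(1)[OF v'] st'_def by auto
  have xP: "x \<notin> contents P" using x(1) st by (auto simp: stored_def)
  have setP: "settled P" using settled st by auto
  then have few: "card (contents P) < 4 * card (ranks (node P))" by (simp add: settled_def)
  have card: "card (contents (push x P)) = card (contents P) + 1"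
    using sound_contents(1)[OF sP] xP by simp
  have stored': "stored st' = insert x (stored st)" by (auto simp: st'_def st stored_def)
  have settled': "\<forall>P' \<in> set st'. P' \<noteq> push x P \<longrightarrow> settled P'"
    using settled by (auto simp: st st'_def)
  let ?mov = "\<lambda>\<omega>. movements (B (node P) \<omega> (base P) (inserted P)) (B (node P) \<omega> (base P) (inserted P @ [x]))"
  note push = box_cost_push[OF sP sP' few xP]
  have potential': "potential st' = potential st + expectation ?mov"
    using push(2) by (simp add: potential_def st st'_def weight_def)
  have movements: "movements (array_labels (\<lambda>P. B P \<omega>) st) (array_labels (\<lambda>P. B P \<omega>) st') = ?mov \<omega>"
    if \<omega>: "\<omega> \<in> space M" for \<omega>
    unfolding st st'_def
  proof (rule movements_array_push)
    show "sorted_wrt sep (L @ P # R)" "sorted_wrt sep (L @ push x P # R)" "x \<notin> stored (L @ P # R)"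
      using v v' x(1) unfolding st st'_def valid_def by blast+
    fix P' assume "P' \<in> {P, push x P} \<union> set L \<union> set R"
    then consider "P' = push x P" | "P' \<in> set st" by (auto simp: st)
    then have "sound P' \<and> card (contents P') \<le> 4 * card (ranks (node P'))"
    proof cases
      case 1
      then show ?thesis using sP' card few by simp
    next
      case 2
      then show ?thesis using validD(1)[OF v] settled by (auto simp: settled_def less_imp_le)
    qed
    then show "dom (actual_labels (\<lambda>P. B P \<omega>) P') = contents P'" using dom_box \<omega> by blast
  qed
  \<comment> \<open>The merge cost does not depend on the random bits: \<open>Init\<close> places
    each element of the new base once.\<close>
  define m where "m = (if overfull (push x P) then card (base (merged Q st')) else 0)"
  have result: "valid (step n st (x, p)) \<and> (\<forall>P' \<in> set (step n st (x, p)). settled P') \<and>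
    stored (step n st (x, p)) = insert x (stored st) \<and>
    potential st' + m \<le> potential (step n st (x, p)) \<and>
    (\<forall>\<omega> \<in> space M. overfull (push x P) \<longrightarrow>
      movements Map.empty (actual_labels (\<lambda>P. B P \<omega>) (merged Q st')) = m)"
  proof (cases "overfull (push x P)")
    case True
    have P': "push x P \<in> set st'" by (simp add: st'_def)
    have few': "card (contents (push x P)) \<le> 4 * card (ranks (node (push x P)))"
      using card few by simp
    have "box_cost (push x P) \<le> \<bar>c0\<bar> * card (base (push x P)) + D * length (inserted (push x P))
        + 4 * card (ranks (node (push x P)))"
      using box_cost_le[OF sP setP] push(2,4) D_pos by (simp add: algebra_simps)
    then have pot: "potential st' + card (base (merged Q st')) \<le> potential (merge Q st')"
      using potential_merge[OF v' P' True few' _ settled'] by (simp add: Q_def)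
    note merge = valid_merge[OF v' P' True few' settled', unfolded push_simps(1), folded Q_def]
    have "sound (merged Q st')" using validD(1)[OF merge(1)] by (simp add: merge_def)
    moreover have base: "contents (merged Q st') = base (merged Q st')" by simp
    ultimately have "dom (actual_labels (\<lambda>P. B P \<omega>) (merged Q st')) = base (merged Q st')"
      if "\<omega> \<in> space M" for \<omega>
      using dom_box[of "merged Q st'" \<omega>] merge(7) that by simp
    then show ?thesis
      using True pot merge(1-3) stored' unfolding step m_def by (simp add: movements_empty)
  next
    case False
    have "card (contents (push x P)) \<le> 3 * card (ranks (node (push x P)))"
      using False overfull_iff[OF sP'] by simp
    moreover have "0 < card (ranks (node (push x P)))"
      using card_ranks[OF sound_contents(4)[OF sP']] by simp
    ultimately have "settled (push x P)" unfolding settled_def by linarith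
    then show ?thesis
      using False v' stored' settled' unfolding step m_def by auto
  qed
  have cost: "cost \<omega> = real (?mov \<omega>) + real m" if "\<omega> \<in> space M" for \<omega>
    using that result movements[OF that] ins st'_i
    by (auto simp: cost_def Let_def m_def i_def[symmetric] Q_def[symmetric])
  show "integrable M cost"
    using push(1) by (subst Bochner_Integration.integrable_cong[OF refl cost]) auto
  have "expectation cost = expectation (\<lambda>\<omega>. real (?mov \<omega>) + real m)"
    by (rule Bochner_Integration.integral_cong[OF refl cost])
  also have "\<dots> = expectation ?mov + m"
    using push(1) by (simp add: prob_space)
  finally show "potential st + expectation cost \<le> potential (step n st (x, p))"
    using result potential' by linarith
  show "valid (step n st (x, p))" "\<And>P. P \<in> set (step n st (x, p)) \<Longrightarrow> settled P"
    "stored (step n st (x, p)) = insert x (stored st)"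
    using result by blast+
qed

text \<open>Ranks and \<open>\<eta>\<close> refer to the complete input, so the induction runs over
  prefixes of the fixed \<open>\<sigma>\<close>. The potential starts at 0: leaves have empty bases
  and height 0.\<close>

lemma run_bound:
  assumes "\<sigma> = \<tau> @ \<rho>"
  shows "valid (run n \<tau>) \<and> (\<forall>P \<in> set (run n \<tau>). settled P) \<and> stored (run n \<tau>) = fst ` set \<tau> \<and>
    integrable M (\<lambda>\<omega>. real (total_cost (\<lambda>P. B P \<omega>) n \<tau>)) \<and>
    expectation (\<lambda>\<omega>. real (total_cost (\<lambda>P. B P \<omega>) n \<tau>)) \<le> potential (run n \<tau>)"
  using assms
proof (induction \<tau> arbitrary: \<rho> rule: rev_induct)
  case Nil
  have "potential (initial_state n) = 0"
    by (simp add: potential_def initial_state_def comp_def weight_def box_cost_def insert_cost_def)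
  then show ?case
    using valid_initial stored_initial by (auto simp: run_def total_cost_def)
next
  case (snoc a \<tau>)
  obtain x p where a: "a = (x, p)" by fastforce
  have IH: "valid (run n \<tau>)" "\<And>P. P \<in> set (run n \<tau>) \<Longrightarrow> settled P" "stored (run n \<tau>) = fst ` set \<tau>"
    "integrable M (\<lambda>\<omega>. real (total_cost (\<lambda>P. B P \<omega>) n \<tau>))"
    "expectation (\<lambda>\<omega>. real (total_cost (\<lambda>P. B P \<omega>) n \<tau>)) \<le> potential (run n \<tau>)"
    using snoc.IH[of "a # \<rho>"] snoc.prems by auto
  have x: "x \<notin> stored (run n \<tau>)" "(x, p) \<in> set \<sigma>"
    using distinct_input snoc.prems by (auto simp: a IH(3))
  note step = step_bound[OF IH(1,2) x]
  have run: "run n (\<tau> @ [a]) = step n (run n \<tau>) (x, p)" by (simp add: run_def a)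
  have cost: "total_cost (\<lambda>P. B P \<omega>) n (\<tau> @ [a])
    = total_cost (\<lambda>P. B P \<omega>) n \<tau> + step_cost (\<lambda>P. B P \<omega>) n (run n \<tau>) (x, p)" for \<omega>
    by (simp add: total_cost_def nth_append a del: step_cost.simps)
  show ?case
    unfolding run cost of_nat_add
    using step IH by (auto simp: a simp del: step.simps step_cost.simps)
qed

text \<open>Here \<open>b\<close> bounds the number of levels in use. All final LLAs are settled, so
  the guarantee applies to each, and disjointness limits their elements and their ranks to
  \<open>n\<close> in total.\<close>

lemma total_bound:
  assumes "\<And>h. 2 ^ h \<le> 2 * \<eta> + 1 \<Longrightarrow> real (h + 1) \<le> b"
  shows "integrable M (\<lambda>\<omega>. real (total_cost (\<lambda>P. B P \<omega>) n \<sigma>))"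
    and "expectation (\<lambda>\<omega>. real (total_cost (\<lambda>P. B P \<omega>) n \<sigma>)) \<le> (\<bar>c0\<bar> * b + D + A * b) * n"
proof -
  define st where "st = run n \<sigma>"
  have v: "valid st" and settled: "\<And>P. P \<in> set st \<Longrightarrow> settled P" and stored: "stored st = fst ` set \<sigma>"
    and E: "expectation (\<lambda>\<omega>. real (total_cost (\<lambda>P. B P \<omega>) n \<sigma>)) \<le> potential st"
    and int: "integrable M (\<lambda>\<omega>. real (total_cost (\<lambda>P. B P \<omega>) n \<sigma>))"
    using run_bound[of \<sigma> "[]"] by (auto simp: st_def)
  \<comment> \<open>Counting height 0 as a level gives \<open>b \<ge> 1\<close>, so the base terms
    can be absorbed into multiples of \<open>b\<close>.\<close>
  have b: "1 \<le> b" using assms[of 0] by simp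
  have A: "0 \<le> A" by (simp add: A_def)
  have "weight P \<le> (\<bar>c0\<bar> * b + D) * card (contents P) + A * b * card (ranks (node P))"
    if P: "P \<in> set st" for P
  proof -
    have s: "sound P" by (rule validD(1)[OF v P])
    have card: "card (contents P) = card (base P) + length (inserted P)"
      by (rule sound_contents(2)[OF s])
    have "2 ^ fst (node P) \<le> 2 * \<eta> + 1"
      using s card_ranks[OF sound_contents(4)[OF s]] by (simp add: sound_def)
    from assms[OF this] have "fst (node P) \<le> b" by simp
    then have "A * fst (node P) * card (ranks (node P)) \<le> A * b * card (ranks (node P))"
      using A by (intro mult_right_mono mult_left_mono) auto
    moreover have "\<bar>c0\<bar> * card (base P) \<le> \<bar>c0\<bar> * (b * card (contents P))"
    proof (rule mult_left_mono)
      have "real (card (base P)) \<le> 1 * real (card (contents P))" using card by simp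
      also have "\<dots> \<le> b * card (contents P)" using b by (intro mult_right_mono) auto
      finally show "real (card (base P)) \<le> b * card (contents P)" .
    qed simp
    ultimately show ?thesis
      using box_cost_le[OF s settled[OF P]] by (simp add: weight_def card algebra_simps)
  qed
  then have "potential st
      \<le> (\<Sum>P\<leftarrow>st. (\<bar>c0\<bar> * b + D) * card (contents P) + A * b * card (ranks (node P)))"
    unfolding potential_def by (intro sum_list_mono)
  also have "\<dots> = (\<bar>c0\<bar> * b + D) * (\<Sum>P\<leftarrow>st. card (contents P)) + A * b * (\<Sum>P\<leftarrow>st. card (ranks (node P)))"
    by (rule sum_list_linear)
  also have "\<dots> \<le> (\<bar>c0\<bar> * b + D) * n + A * b * n"
  proof (intro add_mono mult_left_mono)
    have "(\<Sum>P\<leftarrow>st. card (contents P)) = card (fst ` set \<sigma>)"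
      using valid_sums(1)[OF v valid_distinct[OF v] subset_refl] stored by (simp add: stored_def)
    then show "real (\<Sum>P\<leftarrow>st. card (contents P)) \<le> real n"
      using card_input length_input by simp
    have "(\<Union>P \<in> set st. ranks (node P)) \<subseteq> {1..n}"
      using v ranks_subset_of_tree unfolding valid_def sound_def by blast
    then have "card (\<Union>P \<in> set st. ranks (node P)) \<le> n"
      using card_mono[of "{1..n}"] by fastforce
    then show "real (\<Sum>P\<leftarrow>st. card (ranks (node P))) \<le> real n"
      using valid_sums(2)[OF v valid_distinct[OF v] subset_refl] by simp
  qed (use A b D_pos in auto)
  finally show "expectation (\<lambda>\<omega>. real (total_cost (\<lambda>P. B P \<omega>) n \<sigma>)) \<le> (\<bar>c0\<bar> * b + D + A * b) * n"
    using E by (simp add: algebra_simps)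
  show "integrable M (\<lambda>\<omega>. real (total_cost (\<lambda>P. B P \<omega>) n \<sigma>))" by (rule int)
qed

end

theorem theorem1:
  fixes C :: "nat \<Rightarrow> real" and c0 :: real
  assumes "admissible C"
  shows "\<exists>K. \<forall>n H (M :: 'w measure) (B :: node \<Rightarrow> 'w \<Rightarrow> 'a::linorder lla) (\<sigma> :: ('a \<times> nat) list).
     n = 2 ^ H \<longrightarrow>
     prob_space M \<longrightarrow>
     (\<forall>P \<in> tree n. bounded_lla M C c0 (3 * card (ranks P)) (B P)) \<longrightarrow>
     distinct (map fst \<sigma>) \<longrightarrow>
     length \<sigma> \<le> n \<longrightarrow>
     integrable M (\<lambda>\<omega>. real (total_cost (\<lambda>P. B P \<omega>) n \<sigma>)) \<and>
     (\<integral>\<omega>. real (total_cost (\<lambda>P. B P \<omega>) n \<sigma>) \<partial>M) \<le> K * real n * C (max_error \<sigma>)"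
proof -
  obtain K1 where K1: "\<And>i j. i \<le> 6 * j + 3 \<Longrightarrow> C i \<le> K1 * C j"
    using admissible_quasi_mono[OF assms] by blast
  obtain K2 where K2: "\<And>h j. 2 ^ h \<le> 2 * j + 1 \<Longrightarrow> real (h + 1) \<le> K2 * C j"
    using admissible_log_bound[OF assms] by blast
  \<comment> \<open>This is the factor in \<open>total_bound\<close> for
    \<open>D = K1 * C \<eta>\<close> and \<open>b = K2 * C \<eta>\<close>, with
    \<open>C \<eta>\<close> taken out and \<open>A\<close> written in terms of
    \<open>c0\<close>.\<close>
  define K where "K = \<bar>c0\<bar> * K2 + K1 + (4 * \<bar>c0\<bar> + 8) * K2"
  show ?thesis
  proof (intro exI[of _ K] allI impI)
    fix n H and M :: "'w measure" and B :: "node \<Rightarrow> 'w \<Rightarrow> 'a lla" and \<sigma> :: "('a \<times> nat) list"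
    assume n: "n = 2 ^ H" and M: "prob_space M"
      and B: "\<forall>P \<in> tree n. bounded_lla M C c0 (3 * card (ranks P)) (B P)"
      and \<sigma>: "distinct (map fst \<sigma>)" "length \<sigma> \<le> n"
    interpret prob_space M by (rule M)
    interpret random_boxes n H \<sigma> M B C c0 "K1 * C (max_error \<sigma>)"
    proof
      show "C (3 * 2 ^ h) \<le> K1 * C (max_error \<sigma>)" if "2 ^ h \<le> 2 * max_error \<sigma> + 1" for h
        using that by (intro K1) simp
    qed (use n B \<sigma> assms in \<open>auto simp: admissible_def\<close>)
    show "integrable M (\<lambda>\<omega>. real (total_cost (\<lambda>P. B P \<omega>) n \<sigma>)) \<and>
      (\<integral>\<omega>. real (total_cost (\<lambda>P. B P \<omega>) n \<sigma>) \<partial>M) \<le> K * real n * C (max_error \<sigma>)"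
      using total_bound[of "K2 * C (max_error \<sigma>)", OF K2] by (simp add: K_def A_def algebra_simps)
  qed
qed

end
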